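(* Let $m$ be a positive integer with $p \nmid m$. For any $\alpha \in k \setminus \mathbb{F}_p$ and any $1 \le c \le m-1$, the $k[H]$-module $H^0(X_{m,\alpha}, \Omega_{X_{m, \alpha}})(\zeta_m^c)$ is indecomposable. Moreover, if $\alpha_1, \alpha_2 \in k \setminus \mathbb{F}_p$, $1 \le c \le m-1$, $\boldsymbol{d}(c) \notin \{0, 1, p^2 - 1\}$ and $$H^0(X_{m,\alpha_1},\Omega_{X_{m, \alpha_1}})(\zeta_m^c) \cong H^0(X_{m,\alpha_2},\Omega_{X_{m, \alpha_2}})(\zeta_m^c)$$ as $k[H]$-modules, then $\alpha_1 = \alpha_2$.
   Context: $k$ is an algebraically closed field of characteristic $p>0$ and $\zeta_m \in k$ is a fixed primitive $m$-th root of unity. For $\alpha \in k\setminus \mathbb F_p$, $X_{m,\alpha}$ is the smooth projective curve over $k$ with function field $k(x,z_0,z_1)$ given by $z_0^p - z_0 = x^m$, $z_1^p - z_1 = \alpha x^m$. The group $H = \langle \sigma,\tau\rangle \cong \mathbb{Z}/p \times \mathbb{Z}/p$ acts on it by $\sigma(z_0,z_1,x) = (z_0+1,z_1,x)$, $\tau(z_0,z_1,x) = (z_0,z_1+1,x)$. The group $\mathbb{Z}/m$ acts on $X_{m,\alpha}$, with $1\in\mathbb Z/m$ acting by $(z_0,z_1,x)\mapsto (z_0,z_1,\zeta_m x)$; this action commutes with that of $H$. For a $k$-vector space $V$ with a representation $\rho$ of $\mathbb{Z}/m$, $V(\zeta_m^c) := \{v \in V : \rho(1)v = \zeta_m^c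 v\}$; for $V = H^0(X_{m,\alpha},\Omega_{X_{m,\alpha}})$ (with $\rho(1)$ induced by $x \mapsto \zeta_m x$, $z_i \mapsto z_i$) this is a $k[H]$-module. Put $$\boldsymbol{d}(c) := p^2 - \left\lceil \frac{p^2 c + 1}{m} \right\rceil.$$ A module is called indecomposable here if it is not a direct sum of two nonzero submodules (so the zero module, which occurs when $\boldsymbol d(c)=0$, is allowed). *)

theory Defs
  imports "HOL-Computational_Algebra.Computational_Algebra" "HOL-Library.Poly_Mapping"
begin

section \<open>Fields and Kaehler differentials\<close>

definition primitive_root_of_unity :: "nat \<Rightarrow> 'k::field \<Rightarrow> bool" where
  "primitive_root_of_unity m \<zeta> \<longleftrightarrow> \<zeta> ^ m = 1 \<and> (\<forall>j. 0 < j \<and> j < m \<longrightarrow> \<zeta> ^ j \<noteq> 1)"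

definition field_hom :: "('a::field \<Rightarrow> 'b::field) \<Rightarrow> bool" where
  "field_hom h \<longleftrightarrow> h 1 = 1 \<and> (\<forall>a b. h (a + b) = h a + h b) \<and> (\<forall>a b. h (a * b) = h a * h b)"

definition is_subfield :: "'f::field set \<Rightarrow> bool" where
  "is_subfield S \<longleftrightarrow> 1 \<in> S \<and> (\<forall>a\<in>S. \<forall>b\<in>S. a - b \<in> S \<and> a * b \<in> S) \<and> (\<forall>a\<in>S. inverse a \<in> S)"

definition transcendental_over :: "('k::field \<Rightarrow> 'f::field) \<Rightarrow> 'f \<Rightarrow> bool" where
  "transcendental_over \<iota> x \<longleftrightarrow> (\<forall>q. q \<noteq> 0 \<longrightarrow> poly (map_poly \<iota> q) x \<noteq> 0)"

definition k_automorphism :: "('k::field \<Rightarrow> 'f::field) \<Rightarrow> ('f \<Rightarrow> 'f) \<Rightarrow> bool" where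
  "k_automorphism \<iota> \<phi> \<longleftrightarrow> field_hom \<phi> \<and> bij \<phi> \<and> (\<forall>a. \<phi> (\<iota> a) = \<iota> a)"

text \<open>The free K-vector space on symbols [g], g in K, is the type of finitely supported
  functions K to K; the symbol [g] is \<open>single g 1\<close>, and \<open>single g f\<close> is f[g].\<close>

definition free_scale :: "'f::field \<Rightarrow> ('f \<Rightarrow>\<^sub>0 'f) \<Rightarrow> ('f \<Rightarrow>\<^sub>0 'f)" where
  "free_scale c = Poly_Mapping.map ((*) c)"

definition kaehler_relations :: "('k::field \<Rightarrow> 'f::field) \<Rightarrow> ('f \<Rightarrow>\<^sub>0 'f) set" where
  "kaehler_relations \<iota> =
     {Poly_Mapping.single (a + b) 1 - Poly_Mapping.single a 1 - Poly_Mapping.single b 1 | a b. True}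
   \<union> {Poly_Mapping.single (a * b) 1 - Poly_Mapping.single b a - Poly_Mapping.single a b | a b. True}
   \<union> {Poly_Mapping.single (\<iota> c) 1 | c. True}"

definition formal_eval ::
  "('f::field \<Rightarrow> 'w::ab_group_add \<Rightarrow> 'w) \<Rightarrow> ('f \<Rightarrow> 'w) \<Rightarrow> ('f \<Rightarrow>\<^sub>0 'f) \<Rightarrow> 'w" where
  "formal_eval sc d u = (\<Sum>g\<in>Poly_Mapping.keys u. sc (Poly_Mapping.lookup u g) (d g))"

text \<open>\<open>is_kaehler \<iota> sc d\<close>: the type \<open>'w\<close> with scalar multiplication \<open>sc\<close> and the map d is the module
  of Kaehler differentials of K over k, i.e. [g] \<mapsto> dg identifies it with the quotient of the free
  K-vector space by the subspace spanned by the relations d(a+b) = da + db,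
  d(ab) = a db + b da, dc = 0 for c in k.\<close>

definition is_kaehler ::
  "('k::field \<Rightarrow> 'f::field) \<Rightarrow> ('f \<Rightarrow> 'w::ab_group_add \<Rightarrow> 'w) \<Rightarrow> ('f \<Rightarrow> 'w) \<Rightarrow> bool" where
  "is_kaehler \<iota> sc d \<longleftrightarrow> vector_space sc \<and> surj (formal_eval sc d) \<and>
     {u. formal_eval sc d u = 0} = module.span free_scale (kaehler_relations \<iota>)"

text \<open>The map induced on differentials by a field automorphism \<phi>: \<open>f dg \<mapsto> \<phi>(f) d(\<phi>(g))\<close>.\<close>

definition pullback ::
  "('f::field \<Rightarrow> 'w::ab_group_add \<Rightarrow> 'w) \<Rightarrow> ('f \<Rightarrow> 'w) \<Rightarrow> ('f \<Rightarrow> 'f) \<Rightarrow> 'w \<Rightarrow> 'w" where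
  "pullback sc d \<phi> = (THE T. (\<forall>u v. T (u + v) = T u + T v) \<and>
                            (\<forall>f g. T (sc f (d g)) = sc (\<phi> f) (d (\<phi> g))))"

section \<open>Global regular differentials\<close>

text \<open>The closed points of the smooth projective curve over k with function field K correspond to
  the valuation rings k \<subseteq> O \<subset> K of K/k, O being the local ring at the point.\<close>

definition is_place :: "('k::field \<Rightarrow> 'f::field) \<Rightarrow> 'f set \<Rightarrow> bool" where
  "is_place \<iota> O' \<longleftrightarrow> range \<iota> \<subseteq> O' \<and> O' \<noteq> UNIV \<and>
     (\<forall>a\<in>O'. \<forall>b\<in>O'. a - b \<in> O' \<and> a * b \<in> O') \<and> (\<forall>a. a \<in> O' \<or> inverse a \<in> O')"

text \<open>The stalk of the sheaf of differentials at the point with local ring O, embedded in the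
  rational differentials, consists of the finite sums of f dg with f, g in O.\<close>

definition regular_at ::
  "('f::field \<Rightarrow> 'w::ab_group_add \<Rightarrow> 'w) \<Rightarrow> ('f \<Rightarrow> 'w) \<Rightarrow> 'f set \<Rightarrow> 'w \<Rightarrow> bool" where
  "regular_at sc d O' \<omega> \<longleftrightarrow>
     (\<exists>fgs. set fgs \<subseteq> O' \<times> O' \<and> \<omega> = (\<Sum>(f, g)\<leftarrow>fgs. sc f (d g)))"

definition regular_differentials ::
  "('k::field \<Rightarrow> 'f::field) \<Rightarrow> ('f \<Rightarrow> 'w::ab_group_add \<Rightarrow> 'w) \<Rightarrow> ('f \<Rightarrow> 'w) \<Rightarrow> 'w set" where
  "regular_differentials \<iota> sc d = {\<omega>. \<forall>O'. is_place \<iota> O' \<longrightarrow> regular_at sc d O' \<omega>}"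

section \<open>Modules over a group algebra\<close>

text \<open>A k[H]-module is a k-vector space (a subset V of an ambient vector space with scalar
  multiplication \<open>sc\<close>) with a linear action \<open>act\<close> of the elements of H.\<close>

definition kH_module ::
  "('k::field \<Rightarrow> 'w::ab_group_add \<Rightarrow> 'w) \<Rightarrow> 'h set \<Rightarrow> ('h \<Rightarrow> 'w \<Rightarrow> 'w) \<Rightarrow> 'w set \<Rightarrow> bool" where
  "kH_module sc H act V \<longleftrightarrow> module.subspace sc V \<and>
     (\<forall>h\<in>H. (\<forall>v\<in>V. act h v \<in> V) \<and>
            (\<forall>u\<in>V. \<forall>v\<in>V. act h (u + v) = act h u + act h v) \<and>
            (\<forall>a. \<forall>v\<in>V. act h (sc a v) = sc a (act h v)))"

definition kH_indecomposable ::
  "('k::field \<Rightarrow> 'w::ab_group_add \<Rightarrow> 'w) \<Rightarrow> 'h set \<Rightarrow> ('h \<Rightarrow> 'w \<Rightarrow> 'w) \<Rightarrow> 'w set \<Rightarrow> bool" where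
  "kH_indecomposable sc H act V \<longleftrightarrow> kH_module sc H act V \<and>
     \<not> (\<exists>U1 U2. kH_module sc H act U1 \<and> kH_module sc H act U2 \<and> U1 \<noteq> {0} \<and> U2 \<noteq> {0} \<and>
                U1 \<inter> U2 = {0} \<and> V = {u1 + u2 | u1 u2. u1 \<in> U1 \<and> u2 \<in> U2})"

definition kH_isomorphic ::
  "'h set \<Rightarrow> ('k::field \<Rightarrow> 'w::ab_group_add \<Rightarrow> 'w) \<Rightarrow> ('h \<Rightarrow> 'w \<Rightarrow> 'w) \<Rightarrow> 'w set \<Rightarrow>
   ('k \<Rightarrow> 'v::ab_group_add \<Rightarrow> 'v) \<Rightarrow> ('h \<Rightarrow> 'v \<Rightarrow> 'v) \<Rightarrow> 'v set \<Rightarrow> bool" where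
  "kH_isomorphic H sc1 act1 V1 sc2 act2 V2 \<longleftrightarrow>
     (\<exists>F. bij_betw F V1 V2 \<and> (\<forall>u\<in>V1. \<forall>v\<in>V1. F (u + v) = F u + F v) \<and>
          (\<forall>a. \<forall>v\<in>V1. F (sc1 a v) = sc2 a (F v)) \<and>
          (\<forall>h\<in>H. \<forall>v\<in>V1. F (act1 h v) = act2 h (F v)))"

section \<open>The curves\<close>

text \<open>The data of a curve: its function field \<open>'f\<close> over \<open>'k\<close> (via the embedding \<open>emb\<close>) with
  generators, the space \<open>'w\<close> of its rational differentials with universal derivation
  \<open>dif\<close>, and the automorphisms of the function field through which \<open>\<sigma>\<close>, \<open>\<tau>\<close> and
  \<open>1 \<in> \<int>/m\<close> act.\<close>

record ('k, 'f, 'w) curve =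
  emb :: "'k \<Rightarrow> 'f"
  cx :: 'f
  cz0 :: 'f
  cz1 :: 'f
  smul :: "'f \<Rightarrow> 'w \<Rightarrow> 'w"
  dif :: "'f \<Rightarrow> 'w"
  sigma :: "'f \<Rightarrow> 'f"
  tau :: "'f \<Rightarrow> 'f"
  mu :: "'f \<Rightarrow> 'f"

text \<open>For m > 0 prime to p and \<alpha> outside the prime field, the two Artin--Schreier equations over
  k(x) are automatically irreducible and independent, so the conditions below determine the function
  field k(x, z0, z1), of degree p^2 over k(x), together with the three automorphisms,
  uniquely up to isomorphism.\<close>

definition is_X :: "nat \<Rightarrow> 'k::field \<Rightarrow> 'k \<Rightarrow> ('k, 'f::field, 'w::ab_group_add) curve \<Rightarrow> bool" where
  "is_X m \<zeta> \<alpha> X \<longleftrightarrow>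
     field_hom (emb X) \<and>
     transcendental_over (emb X) (cx X) \<and>
     is_subfield hull (range (emb X) \<union> {cx X, cz0 X, cz1 X}) = UNIV \<and>
     cz0 X ^ CHAR('k) - cz0 X = cx X ^ m \<and>
     cz1 X ^ CHAR('k) - cz1 X = emb X \<alpha> * cx X ^ m \<and>
     is_kaehler (emb X) (smul X) (dif X) \<and>
     k_automorphism (emb X) (sigma X) \<and>
       sigma X (cz0 X) = cz0 X + 1 \<and> sigma X (cz1 X) = cz1 X \<and> sigma X (cx X) = cx X \<and>
     k_automorphism (emb X) (tau X) \<and>
       tau X (cz0 X) = cz0 X \<and> tau X (cz1 X) = cz1 X + 1 \<and> tau X (cx X) = cx X \<and>
     k_automorphism (emb X) (mu X) \<and>
       mu X (cz0 X) = cz0 X \<and> mu X (cz1 X) = cz1 X \<and> mu X (cx X) = emb X \<zeta> * cx X"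

definition k_scale :: "('k, 'f, 'w) curve \<Rightarrow> 'k \<Rightarrow> 'w \<Rightarrow> 'w" where
  "k_scale X a \<omega> = smul X (emb X a) \<omega>"

text \<open>The pair (i, j) stands for the element \<open>\<sigma>^i \<tau>^j\<close> of H.\<close>

definition H_group :: "nat \<Rightarrow> (nat \<times> nat) set" where
  "H_group p = {..<p} \<times> {..<p}"

definition H_act :: "('k, 'f::field, 'w::ab_group_add) curve \<Rightarrow> nat \<times> nat \<Rightarrow> 'w \<Rightarrow> 'w" where
  "H_act X = (\<lambda>(i, j). (pullback (smul X) (dif X) (sigma X) ^^ i) \<circ>
                        (pullback (smul X) (dif X) (tau X) ^^ j))"

definition H0_Omega :: "('k::field, 'f::field, 'w::ab_group_add) curve \<Rightarrow> 'w set" where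
  "H0_Omega X = regular_differentials (emb X) (smul X) (dif X)"

definition H0_Omega_eigen :: "('k::field, 'f::field, 'w::ab_group_add) curve \<Rightarrow> 'k \<Rightarrow> 'w set" where
  "H0_Omega_eigen X l =
     {\<omega> \<in> H0_Omega X. pullback (smul X) (dif X) (mu X) \<omega> = k_scale X l \<omega>}"

definition d_bold :: "nat \<Rightarrow> nat \<Rightarrow> nat \<Rightarrow> int" where
  "d_bold p m c = int (p ^ 2) - \<lceil>(real (p ^ 2 * c) + 1) / real m\<rceil>"

end

theory Submission
  imports Defs
begin

text \<open>
  The curve has an equation in two variables. Choose \<open>\<beta>\<close> with \<open>\<beta>^p = \<alpha>\<close> and put
  \<open>w = z1 - \<beta> z0\<close>, \<open>\<gamma> = \<beta> - \<alpha>\<close>. Taking p-th powers gives \<open>w^p - w = \<gamma> z0\<close>, so both \<open>z0\<close> and \<open>z1\<close> are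
  polynomials in w, and the function field is \<open>k(x, w)\<close> with \<open>x^m = A(w)\<close>, where A has degree \<open>p^2\<close> and
  the constant derivative \<open>1/\<gamma>\<close>. Here \<open>\<gamma>\<close> is nonzero because \<open>\<alpha>\<close> is outside the prime field. In these
  coordinates \<open>\<sigma>\<close> is \<open>w \<mapsto> w - \<beta>\<close> and \<open>\<tau>\<close> is \<open>w \<mapsto> w + 1\<close>.

  The affine curve \<open>x^m = A(w)\<close> is smooth, because A' has no zero; dx has no zero on it, and there is one
  point at infinity, where w and x have poles of the coprime orders m and \<open>p^2\<close>. Consequently the
  \<open>\<zeta>^c\<close>-eigenspace is the set of \<open>x^(c-1) f(w) dx\<close> with f a polynomial of degree less than d(c)
  (lemma \<open>eigenspace\<close>). One inclusion is \<open>regular_monomials\<close>: at a place where x has a pole, the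
  differential is rewritten as a multiple of dt for a monomial t of order 1. The other uses
  the eigenspaces of the function field, which are \<open>k(w) x^l\<close> (\<open>eigenfunction\<close>), and explicit
  places: a root of the equation in the field of Laurent series extends to an embedding of the function
  field (\<open>extend_to_point\<close>), the power series cut out a place, and the universal property of Kaehler
  differentials turns \<open>f dg\<close> into \<open>f g'\<close>, computed in Laurent series (\<open>regular_laurent\<close>). The branches
  \<open>w = b + t^m\<close> exclude poles of f (\<open>regular_no_pole\<close>), and \<open>w = t^(-m)\<close> bounds its degree
  (\<open>regular_degree_bound\<close>).

  It remains to study polynomials f of degree less than \<open>d < p^2\<close> under the translations
  by the \<open>p^2\<close> points \<open>j - i \<beta>\<close> (locale \<open>translation_module\<close>). A polynomial of least degree in a nonzero
  submodule is fixed by all translations, so it takes one value at \<open>p^2\<close> points and is constant. Hence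
  any two nonzero submodules share the constants, and the module is indecomposable.

  An isomorphism F from the module of \<open>\<beta>1\<close> to that of \<open>\<beta>2\<close> is evaluated through the functional \<open>f \<mapsto> F(f)(0)\<close>:
  applied to the translates of f it gives, by Taylor expansion, a polynomial in the translation
  of degree less than d. So every function \<open>(i, j) \<mapsto> g(j - i \<beta>2)\<close> with \<open>deg g < d\<close> is also
  \<open>(i, j) \<mapsto> Q(j - i \<beta>1)\<close> with \<open>deg Q < d\<close>. On the other hand the coordinate \<open>j - i \<beta>2\<close> is a
  combination \<open>(1 - v) y + v y^p\<close> of \<open>y = j - i \<beta>1\<close>, with \<open>v = 0\<close> only if \<open>\<beta>1 = \<beta>2\<close>. Comparing degrees for
  \<open>g = w\<close> or \<open>g = w^(p-1)\<close> excludes \<open>v \<noteq> 0\<close> when \<open>2 \<le> d \<le> p(p-1)\<close>. For larger d it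
  is excluded by power sums: by Lagrange interpolation, summation over the lattice kills polynomials of
  degree less than \<open>p^2 - 1\<close> but not \<open>w^(p^2 - 1)\<close>, and the latter occurs in the product of
  \<open>w^(p^2 - 1 - p)\<close> with \<open>w^p\<close> (\<open>lattice_parameter_unique\<close>). So \<open>\<beta>1 = \<beta>2\<close>, and \<open>\<alpha>1 = \<alpha>2\<close> by taking p-th powers.
\<close>

section \<open>Ring homomorphisms and evaluation of polynomials\<close>

text \<open>Evaluation of polynomials in two variables goes through homomorphisms from the ring \<open>k[w]\<close>, which is
  not a field.\<close>

definition is_ring_hom :: "('a::comm_ring_1 \<Rightarrow> 'b::comm_ring_1) \<Rightarrow> bool" where
  "is_ring_hom h \<longleftrightarrow> h 1 = 1 \<and> (\<forall>a b. h (a + b) = h a + h b) \<and> (\<forall>a b. h (a * b) = h a * h b)"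

lemma is_ring_hom_field [simp]: "is_ring_hom h \<longleftrightarrow> field_hom h"
  for h :: "'a::field \<Rightarrow> 'b::field"
  by (simp add: is_ring_hom_def field_hom_def)

lemma is_ring_homD:
  assumes "is_ring_hom h"
  shows "h 0 = 0" "h 1 = 1" "h (a + b) = h a + h b" "h (a * b) = h a * h b"
    "h (- a) = - h a" "h (a - b) = h a - h b" "h (a ^ n) = h a ^ n" "h (of_nat j) = of_nat j"
proof -
  show add: "h (a + b) = h a + h b" for a b using assms by (simp add: is_ring_hom_def)
  show mult: "h (a * b) = h a * h b" for a b using assms by (simp add: is_ring_hom_def)
  show one: "h 1 = 1" using assms by (simp add: is_ring_hom_def)
  show zero: "h 0 = 0" using add[of 0 0] by simp
  show neg: "h (- a) = - h a" for a
    using add[of a "- a"] zero by (simp add: eq_neg_iff_add_eq_0 add.commute)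
  show "h (a - b) = h a - h b" using add[of a "- b"] neg by simp
  show "h (a ^ n) = h a ^ n" by (induction n) (auto simp: one mult)
  show "h (of_nat j) = of_nat j" by (induction j) (auto simp: one add zero)
qed

lemma is_ring_hom_sum: "is_ring_hom h \<Longrightarrow> h (sum f S) = (\<Sum>i\<in>S. h (f i))"
  by (induction S rule: infinite_finite_induct) (simp_all add: is_ring_homD(1,3)[of h])

lemma is_ring_hom_prod: "is_ring_hom h \<Longrightarrow> h (prod f S) = (\<Prod>i\<in>S. h (f i))"
  by (induction S rule: infinite_finite_induct) (simp_all add: is_ring_homD(2,4)[of h])

lemmas field_homD = is_ring_homD[OF iffD2[OF is_ring_hom_field]]

lemma field_hom_eq_0_iff:
  assumes h: "field_hom h"
  shows "h a = 0 \<longleftrightarrow> a = 0"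
proof
  assume "h a = 0"
  hence "h (a * inverse a) = 0" by (simp add: field_homD(4)[OF h])
  thus "a = 0" by (cases "a = 0") (simp_all add: field_homD(2)[OF h])
qed (simp add: field_homD(1)[OF h])

lemma field_hom_inverse:
  assumes h: "field_hom h"
  shows "h (inverse a) = inverse (h a)"
proof (cases "a = 0")
  case False
  hence "h a * h (inverse a) = 1" by (simp add: field_homD(2)[OF h] flip: field_homD(4)[OF h])
  thus ?thesis by (simp add: inverse_unique)
qed (simp add: field_homD(1)[OF h])

lemma field_hom_of_int:
  assumes h: "field_hom h"
  shows "h (of_int s) = of_int s"
  by (cases s) (simp_all only: of_int_minus of_int_of_nat_eq field_homD[OF h])

lemma field_hom_divide: "field_hom h \<Longrightarrow> h (a / b) = h a / h b"
  by (simp add: divide_inverse field_homD(4)[of h] field_hom_inverse[of h])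

lemma field_hom_funpow: "field_hom (g :: 'a::field \<Rightarrow> 'a) \<Longrightarrow> field_hom (g ^^ n)"
  by (induction n) (auto simp: field_hom_def)

text \<open>Evaluation with coefficients carried along h. Iterating it evaluates elements of \<open>k[w][x]\<close> without
  a type of polynomials in two variables.\<close>

definition evp :: "('a::comm_ring_1 \<Rightarrow> 'b::comm_ring_1) \<Rightarrow> 'b \<Rightarrow> 'a poly \<Rightarrow> 'b" where
  "evp h y P = poly (map_poly h P) y"

lemma evp_0 [simp]: "evp h y 0 = 0"
  by (simp add: evp_def)

lemma evp_pCons:
  "is_ring_hom h \<Longrightarrow> evp h y (pCons a P) = h a + y * evp h y P"
  by (simp add: evp_def map_poly_pCons is_ring_homD[of h])

lemma evp_altdef:
  assumes "is_ring_hom h" "degree P < n"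
  shows "evp h y P = (\<Sum>i<n. h (coeff P i) * y ^ i)"
  using assms(2)
proof (induction n arbitrary: P)
  case (Suc n)
  obtain a Q where P: "P = pCons a Q" by (cases P)
  show ?case
  proof (cases "Q = 0")
    case True
    thus ?thesis using assms(1)
      by (subst sum.lessThan_Suc_shift) (auto simp: P evp_pCons is_ring_homD[of h])
  next
    case False
    hence "degree Q < n" using Suc.prems by (simp add: P)
    thus ?thesis using assms(1) Suc.IH[of Q]
      by (subst sum.lessThan_Suc_shift)
        (auto simp: P evp_pCons is_ring_homD[of h] sum_distrib_left mult_ac)
  qed
qed auto

lemma is_ring_hom_evp:
  assumes h: "is_ring_hom h"
  shows "is_ring_hom (evp h y)"
proof -
  have add: "evp h y (P + Q) = evp h y P + evp h y Q" for P Q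
    by (induction P Q rule: poly_induct2) (auto simp: evp_pCons[OF h] is_ring_homD[OF h] algebra_simps)
  have smult: "evp h y (smult a Q) = h a * evp h y Q" for a Q
    by (simp add: evp_def map_poly_smult is_ring_homD[OF h])
  have "evp h y (P * Q) = evp h y P * evp h y Q" for P Q
    by (induction P) (auto simp: evp_pCons[OF h] is_ring_homD[OF h] add smult algebra_simps)
  moreover have "evp h y 1 = 1" by (simp add: evp_pCons[OF h] is_ring_homD[OF h] one_pCons)
  ultimately show ?thesis by (simp add: is_ring_hom_def add)
qed

lemmas evpD = is_ring_homD[OF is_ring_hom_evp]

lemma evp_const [simp]: "is_ring_hom h \<Longrightarrow> evp h y [:a:] = h a"
  by (simp add: evp_pCons)

lemma evp_X [simp]: "is_ring_hom h \<Longrightarrow> evp h y [:0, 1:] = y"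
  by (simp add: evp_pCons is_ring_homD[of h])

lemma evp_smult: "is_ring_hom h \<Longrightarrow> evp h y (smult a P) = h a * evp h y P"
  using evpD(4)[of h y "[:a:]" P] by simp

lemma evp_monom: "is_ring_hom h \<Longrightarrow> evp h y (monom a n) = h a * y ^ n"
  by (simp add: evp_def map_poly_monom is_ring_homD[of h] poly_monom)

lemma evp_hom_comp:
  "is_ring_hom g \<Longrightarrow> is_ring_hom h \<Longrightarrow> g (evp h y P) = evp (\<lambda>a. g (h a)) (g y) P"
proof (induction P)
  case (pCons a P)
  moreover from pCons(3,4) have "is_ring_hom (\<lambda>a. g (h a))" by (simp add: is_ring_hom_def)
  ultimately show ?case by (simp add: evp_pCons is_ring_homD[of g])
qed (simp add: is_ring_homD[of g])

lemma evp_pcompose: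
  "is_ring_hom h \<Longrightarrow> evp h y (pcompose P Q) = evp h (evp h y Q) P"
  by (induction P) (simp_all add: pcompose_pCons evp_pCons evpD[of h y])

text \<open>Over an algebraically closed field every polynomial splits into linear factors, so an element that is not a constant is transcendental.\<close>

lemma evp_eq_0_iff:
  fixes h :: "'k::alg_closed_field \<Rightarrow> 'f::field"
  assumes h: "field_hom h" and y: "y \<notin> range h"
  shows "evp h y P = 0 \<longleftrightarrow> P = 0"
proof
  show "P = 0" if "evp h y P = 0"
    using that
  proof (induction "degree P" arbitrary: P rule: less_induct)
    case less
    show ?case
    proof (cases "degree P = 0")
      case True
      then obtain a where "P = [:a:]" by (metis degree_eq_zeroE)
      thus ?thesis using less.prems h by (simp add: field_hom_eq_0_iff)
    next
      case False
      then obtain b where "poly P b = 0" using alg_closed_imp_poly_has_root[of P] by auto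
      then obtain Q where Q: "P = [:-b, 1:] * Q" using poly_eq_0_iff_dvd by blast
      with False have nz: "Q \<noteq> 0" by auto
      have "(y - h b) * evp h y Q = 0"
        using less.prems h unfolding Q by (simp only: evpD(4)[of h] is_ring_hom_field) (simp add: evp_pCons[of h] field_homD[OF h])
      moreover have "y \<noteq> h b" using y by auto
      ultimately have "evp h y Q = 0" by simp
      moreover have "degree Q < degree P"
        using nz unfolding Q by (subst degree_mult_eq) auto
      ultimately have "Q = 0" using less.hyps by blast
      thus ?thesis using nz by simp
    qed
  qed
qed simp

lemma is_subfieldD:
  assumes "is_subfield S"
  shows "1 \<in> S" "0 \<in> S" "a \<in> S \<Longrightarrow> b \<in> S \<Longrightarrow> a - b \<in> S" "a \<in> S \<Longrightarrow> b \<in> S \<Longrightarrow> a * b \<in> S"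
    "a \<in> S \<Longrightarrow> b \<in> S \<Longrightarrow> a + b \<in> S" "a \<in> S \<Longrightarrow> inverse a \<in> S" "a \<in> S \<Longrightarrow> b \<in> S \<Longrightarrow> a / b \<in> S"
    "a \<in> S \<Longrightarrow> a ^ n \<in> S"
proof -
  show one: "1 \<in> S" and diff: "a \<in> S \<Longrightarrow> b \<in> S \<Longrightarrow> a - b \<in> S"
    and mult: "a \<in> S \<Longrightarrow> b \<in> S \<Longrightarrow> a * b \<in> S" and inv: "a \<in> S \<Longrightarrow> inverse a \<in> S" for a b
    using assms by (auto simp: is_subfield_def)
  show zero: "0 \<in> S" using one diff[of 1 1] by simp
  show "a \<in> S \<Longrightarrow> b \<in> S \<Longrightarrow> a + b \<in> S" using diff[of a "0 - b"] diff[of 0 b] zero by simp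
  show "a \<in> S \<Longrightarrow> b \<in> S \<Longrightarrow> a / b \<in> S" by (simp add: divide_inverse mult inv)
  show "a \<in> S \<Longrightarrow> a ^ n \<in> S" by (induction n) (auto simp: one mult)
qed

text \<open>The form in which generation of the function field is used: a subfield that contains the generators is everything.\<close>

lemma subfield_hull_induct:
  assumes "is_subfield hull G = UNIV" "is_subfield S" "G \<subseteq> S"
  shows "a \<in> S"
  using assms hull_minimal[of G S is_subfield] by blast

section \<open>Superelliptic function fields\<close>

lemma primitive_root_pow_eq_1_iff:
  assumes "primitive_root_of_unity m \<zeta>" "m > 0"
  shows "\<zeta> ^ n = 1 \<longleftrightarrow> m dvd n"
proof -
  have z: "\<zeta> ^ m = 1" using assms by (simp add: primitive_root_of_unity_def)
  have "\<zeta> ^ n = \<zeta> ^ (m * (n div m) + n mod m)" by simp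
  also have "\<dots> = \<zeta> ^ (n mod m)" by (subst power_add, subst power_mult) (simp add: z)
  finally have *: "\<zeta> ^ n = \<zeta> ^ (n mod m)" .
  show ?thesis
  proof
    assume "\<zeta> ^ n = 1"
    hence "\<not> n mod m > 0" using assms * by (auto simp: primitive_root_of_unity_def)
    thus "m dvd n" by auto
  next
    assume "m dvd n" thus "\<zeta> ^ n = 1" by (auto simp: power_mult z)
  qed
qed

lemma sum_powers_root_of_unity:
  fixes u :: "'a::field"
  assumes "u ^ m = 1" "u \<noteq> 1"
  shows "(\<Sum>j<m. u ^ j) = 0"
  using assms sum_gp_strict[of u m] by simp

text \<open>The field \<open>k(w, x)\<close> with \<open>x^m = A(w)\<close>. The automorphism \<open>\<mu>\<close> replaces an irreducibility argument: its
  eigenvalues separate the powers \<open>1, x, ..., x^(m-1)\<close>, which are therefore linearly independent over \<open>k(w)\<close>.\<close>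

locale superelliptic =
  fixes \<iota> :: "'k::alg_closed_field \<Rightarrow> 'f::field" and w x :: 'f and A :: "'k poly"
    and m :: nat and \<zeta> :: 'k and \<mu> :: "'f \<Rightarrow> 'f"
  assumes \<iota>: "field_hom \<iota>" and m: "m > 0" "of_nat m \<noteq> (0::'k)"
    and \<zeta>: "primitive_root_of_unity m \<zeta>"
    and eqn: "x ^ m = evp \<iota> w A" and w: "w \<notin> range \<iota>"
    and A: "A \<noteq> 0"
    and \<mu>: "field_hom \<mu>" "\<And>a. \<mu> (\<iota> a) = \<iota> a" "\<mu> w = w" "\<mu> x = \<iota> \<zeta> * x"
    and gen: "is_subfield hull (range \<iota> \<union> {w, x}) = UNIV"
begin

abbreviation ev :: "'k poly \<Rightarrow> 'f" where "ev \<equiv> evp \<iota> w"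
abbreviation ev2 :: "'k poly poly \<Rightarrow> 'f" where "ev2 \<equiv> evp ev x"

lemma hom_ev: "is_ring_hom ev" and hom_ev2: "is_ring_hom ev2"
  using \<iota> by (auto intro!: is_ring_hom_evp)

lemmas evD = is_ring_homD[OF hom_ev]
lemmas ev2D = is_ring_homD[OF hom_ev2]

lemma ev_eq_0_iff [simp]: "ev P = 0 \<longleftrightarrow> P = 0"
  using \<iota> w by (rule evp_eq_0_iff)

lemma x_nz: "x \<noteq> 0"
  using eqn A m by (auto simp: power_0_left)

definition curve_poly :: "'k poly poly" where "curve_poly = monom 1 m - [:A:]"

lemma degree_curve_poly: "degree curve_poly = m" and lead_coeff_curve_poly: "coeff curve_poly m = 1"
proof -
  show "coeff curve_poly m = 1" using m by (auto simp: curve_poly_def coeff_pCons split: nat.splits)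
  have "degree curve_poly \<le> m" unfolding curve_poly_def
    by (rule degree_diff_le) (auto simp: degree_monom_eq)
  moreover have "m \<le> degree curve_poly" by (rule le_degree) (simp add: \<open>coeff curve_poly m = 1\<close>)
  ultimately show "degree curve_poly = m" by simp
qed

lemma division_by_curve_poly: obtains S R where "P = curve_poly * S + R" "degree R < m"
proof -
  obtain S R where SR: "pseudo_divmod P curve_poly = (S, R)" by (cases "pseudo_divmod P curve_poly")
  have nz: "curve_poly \<noteq> 0" using lead_coeff_curve_poly by auto
  from pseudo_divmod[OF nz SR] have "P = curve_poly * S + R" "R = 0 \<or> degree R < m"
    by (simp_all add: degree_curve_poly lead_coeff_curve_poly)
  with m that show ?thesis by (metis degree_0)
qed

lemma ev2_low: "degree R < m \<Longrightarrow> ev2 R = (\<Sum>i<m. ev (coeff R i) * x ^ i)"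
  by (intro evp_altdef hom_ev)

lemma \<mu>_ev [simp]: "\<mu> (ev q) = ev q"
  using evp_hom_comp[of \<mu> \<iota> w q] \<mu> \<iota> by simp

lemma \<mu>_pow:
  shows "(\<mu> ^^ j) (ev q) = ev q" "(\<mu> ^^ j) x = \<iota> (\<zeta> ^ j) * x"
  by (induction j) (simp_all add: \<mu> field_homD[OF \<mu>(1)] field_homD[OF \<iota>] mult_ac)

lemma \<mu>_pow_low:
  assumes "degree R < m"
  shows "(\<mu> ^^ j) (ev2 R) = (\<Sum>i<m. \<iota> (\<zeta> ^ (j * i)) * (ev (coeff R i) * x ^ i))"
proof -
  have h: "field_hom (\<mu> ^^ j)" using \<mu>(1) by (rule field_hom_funpow)
  note hs = is_ring_hom_sum[of "\<mu> ^^ j", unfolded is_ring_hom_field, OF h]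
  show ?thesis unfolding ev2_low[OF assms] hs
    by (intro sum.cong refl)
      (simp add: field_homD[OF h] \<mu>_pow power_mult_distrib field_homD[OF \<iota>] mult_ac flip: power_mult)
qed

text \<open>Orthogonality of characters: averaging the \<open>\<mu>\<close>-translates against the l-th character isolates the
  term with \<open>x^l\<close>. The exponent \<open>m - l\<close> stands for \<open>-l\<close>.\<close>

lemma eigen_projection:
  assumes R: "degree R < m" and l: "l < m"
  shows "of_nat m * (ev (coeff R l) * x ^ l) = (\<Sum>j<m. \<iota> (\<zeta> ^ (j * (m - l))) * (\<mu> ^^ j) (ev2 R))"
proof -
  let ?t = "\<lambda>i. ev (coeff R i) * x ^ i"
  have "(\<Sum>j<m. \<iota> (\<zeta> ^ (j * (m - l))) * (\<mu> ^^ j) (ev2 R))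
      = (\<Sum>j<m. \<Sum>i<m. \<iota> ((\<zeta> ^ (i + (m - l))) ^ j) * ?t i)"
    unfolding \<mu>_pow_low[OF R] sum_distrib_left
  proof (intro sum.cong refl)
    fix j i
    have "\<zeta> ^ (j * (m - l)) * \<zeta> ^ (j * i) = (\<zeta> ^ (i + (m - l))) ^ j"
      by (simp add: distrib_left mult.commute flip: power_mult power_add)
    thus "\<iota> (\<zeta> ^ (j * (m - l))) * (\<iota> (\<zeta> ^ (j * i)) * ?t i)
        = \<iota> ((\<zeta> ^ (i + (m - l))) ^ j) * ?t i"
      by (metis field_homD(4)[OF \<iota>] mult.assoc)
  qed
  also have "\<dots> = (\<Sum>i<m. \<iota> (\<Sum>j<m. (\<zeta> ^ (i + (m - l))) ^ j) * ?t i)"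
    by (subst sum.swap) (simp add: sum_distrib_right is_ring_hom_sum[of \<iota>] \<iota>)
  also have "\<dots> = (\<Sum>i<m. if i = l then of_nat m * ?t l else 0)"
  proof (intro sum.cong refl)
    fix i assume i: "i \<in> {..<m}"
    show "\<iota> (\<Sum>j<m. (\<zeta> ^ (i + (m - l))) ^ j) * ?t i = (if i = l then of_nat m * ?t l else 0)"
    proof (cases "i = l")
      case True
      hence "\<zeta> ^ (i + (m - l)) = 1"
        using l \<zeta> by (simp add: primitive_root_of_unity_def)
      thus ?thesis using True by (simp add: field_homD[OF \<iota>])
    next
      case False
      have "\<not> m dvd i + (m - l)"
      proof
        assume "m dvd i + (m - l)"
        hence *: "m dvd i + m - l" using l by simp
        have "0 < i + m - l" "i + m - l < 2 * m" using l i by auto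
        then obtain c where c: "i + m - l = m * c" "0 < m * c" "m * c < m * 2"
          using * by (metis dvdE mult.commute)
        hence "c = 1" using m by auto
        thus False using False l c by simp
      qed
      hence "\<zeta> ^ (i + (m - l)) \<noteq> 1"
        using primitive_root_pow_eq_1_iff[OF \<zeta>] m by blast
      moreover have "(\<zeta> ^ (i + (m - l))) ^ m = 1"
        using \<zeta> by (metis power_mult mult.commute power_one primitive_root_of_unity_def)
      ultimately show ?thesis
        using False sum_powers_root_of_unity[of "\<zeta> ^ (i + (m - l))" m] by (simp add: field_homD[OF \<iota>])
    qed
  qed
  also have "\<dots> = of_nat m * ?t l" using l by simp
  finally show ?thesis ..
qed

lemma m_nz: "of_nat m \<noteq> (0::'f)"
  using m(2) field_hom_eq_0_iff[OF \<iota>, of "of_nat m"] by (simp add: field_homD[OF \<iota>])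

lemma ev2_low_eq_0:
  assumes "degree R < m" "ev2 R = 0"
  shows "R = 0"
proof (rule poly_eqI)
  fix l show "coeff R l = coeff 0 l"
  proof (cases "l < m")
    case True
    have "(\<mu> ^^ j) 0 = 0" for j using field_homD(1)[OF field_hom_funpow[OF \<mu>(1)]] .
    hence "of_nat m * (ev (coeff R l) * x ^ l) = 0"
      using eigen_projection[OF assms(1) True] assms(2) by simp
    thus ?thesis using m_nz x_nz by simp
  next
    case False thus ?thesis using assms(1) by (simp add: coeff_eq_0)
  qed
qed

lemma ev2_curve_poly: "ev2 curve_poly = 0"
  using eqn by (simp add: curve_poly_def ev2D(6) evp_monom[OF hom_ev] hom_ev evD(2))

text \<open>All relations between w and x over k follow from the equation of the curve. This makes the
  coordinate ring a quotient of \<open>k[w][x]\<close> from which homomorphisms can be defined.\<close>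

lemma ev2_eq_0_iff: "ev2 P = 0 \<longleftrightarrow> curve_poly dvd P"
proof
  assume *: "ev2 P = 0"
  obtain S R where P: "P = curve_poly * S + R" "degree R < m" by (rule division_by_curve_poly)
  with * have "R = 0" by (intro ev2_low_eq_0) (auto simp: ev2D ev2_curve_poly)
  thus "curve_poly dvd P" using P by simp
qed (auto simp: ev2D ev2_curve_poly)

text \<open>The l-th eigenspace of \<open>\<mu>\<close> in the coordinate ring is \<open>k[w] x^l\<close>, since the averages in
  \<open>eigen_projection\<close> all equal the given element.\<close>

lemma eigen_component:
  assumes "\<mu> (ev2 P) = \<iota> (\<zeta> ^ l) * ev2 P" "l < m"
  obtains q where "ev2 P = ev q * x ^ l"
proof -
  obtain S R where P: "P = curve_poly * S + R" "degree R < m" by (rule division_by_curve_poly)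
  hence eq: "ev2 P = ev2 R" by (simp add: ev2D ev2_curve_poly)
  have "(\<mu> ^^ j) (ev2 R) = \<iota> (\<zeta> ^ (l * j)) * ev2 R" for j
  proof (induction j)
    case (Suc j)
    thus ?case using assms(1)
      by (simp add: eq \<mu> field_homD[OF \<mu>(1)] field_homD[OF \<iota>] power_add mult_ac)
  qed (simp add: field_homD[OF \<iota>])
  \<comment> \<open>The weight of the average cancels the eigenvalue.\<close>
  moreover have "\<iota> (\<zeta> ^ (j * (m - l))) * \<iota> (\<zeta> ^ (l * j)) = 1" for j
  proof -
    have "j * (m - l) + l * j = m * j"
      using assms(2) by (simp add: algebra_simps diff_mult_distrib2)
    hence "\<zeta> ^ (j * (m - l)) * \<zeta> ^ (l * j) = (\<zeta> ^ m) ^ j"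
      by (metis power_add power_mult)
    thus ?thesis using \<zeta>
      by (simp add: primitive_root_of_unity_def field_homD(2)[OF \<iota>] flip: field_homD(4)[OF \<iota>])
  qed
  ultimately have "\<iota> (\<zeta> ^ (j * (m - l))) * (\<mu> ^^ j) (ev2 R) = ev2 R" for j
    by (simp flip: mult.assoc)
  hence "of_nat m * (ev (coeff R l) * x ^ l) = of_nat m * ev2 R"
    using eigen_projection[OF P(2) assms(2)] by simp
  hence "ev2 R = ev (coeff R l) * x ^ l" using m_nz by simp
  thus ?thesis using that[of "coeff R l"] eq by argo
qed

lemma \<mu>_range_ev2: "\<exists>Q. (\<mu> ^^ j) (ev2 P) = ev2 Q"
proof -
  have h: "field_hom (\<mu> ^^ j)" using \<mu>(1) by (rule field_hom_funpow)
  have 1: "(\<mu> ^^ j) (ev2 P) = evp ev (\<iota> (\<zeta> ^ j) * x) P"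
    using evp_hom_comp[of "\<mu> ^^ j" ev x P] h hom_ev by (simp add: \<mu>_pow)
  also have "\<iota> (\<zeta> ^ j) * x = ev2 [:0, [:\<zeta> ^ j:]:]"
    using \<iota> by (simp add: evp_pCons hom_ev field_homD[OF \<iota>] mult.commute)
  finally show ?thesis
    by (subst (asm) evp_pcompose[OF hom_ev, symmetric]) blast
qed

text \<open>The norm of the denominator: the product of all \<open>\<mu>\<close>-translates is invariant, so it lies in \<open>k[w]\<close>.\<close>

lemma polynomial_multiple:
  assumes "ev2 Q \<noteq> 0"
  obtains Q' D where "D \<noteq> 0" "ev2 Q * ev2 Q' = ev D"
proof -
  obtain S R where R: "Q = curve_poly * S + R" "degree R < m" by (rule division_by_curve_poly)
  hence eq: "ev2 Q = ev2 R" by (simp add: ev2D ev2_curve_poly)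
  obtain q where q: "\<And>j. (\<mu> ^^ j) (ev2 Q) = ev2 (q j)" using \<mu>_range_ev2[where P = Q] by metis
  let ?N = "\<Prod>j<m. q j" let ?Q' = "\<Prod>j\<in>{1..<m}. q j"
  have "{..<m} = insert 0 {1..<m}" using m by auto
  hence "ev2 ?N = ev2 (q 0) * ev2 ?Q'" by (simp add: ev2D)
  hence N: "ev2 ?N = ev2 Q * ev2 ?Q'" using q[of 0] by simp
  have "(\<mu> ^^ m) (ev2 R) = ev2 R"
    using \<zeta> unfolding \<mu>_pow_low[OF R(2)]
    by (simp add: power_mult primitive_root_of_unity_def field_homD(2)[OF \<iota>] ev2_low[OF R(2)])
  \<comment> \<open>As \<open>\<mu>^m\<close> is the identity on the coordinate ring, \<open>\<mu>\<close> permutes the factors of the product cyclically.\<close>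
  hence per: "ev2 (q m) = ev2 (q 0)" using q[of m] q[of 0] eq by simp
  have nz: "ev2 (q j) \<noteq> 0" for j
    using assms q[of j] field_hom_eq_0_iff[OF field_hom_funpow[OF \<mu>(1)]] by metis
  have shift: "\<mu> (ev2 (q j)) = ev2 (q (Suc j))" for j by (simp flip: q)
  have "\<mu> (ev2 ?N) = (\<Prod>j<m. ev2 (q (Suc j)))"
    using \<mu>(1) by (simp add: is_ring_hom_prod[OF hom_ev2] is_ring_hom_prod[of \<mu>] shift)
  also have "\<dots> * ev2 (q 0) = (\<Prod>j<Suc m. ev2 (q j))"
    by (subst prod.lessThan_Suc_shift) simp
  also have "\<dots> = ev2 ?N * ev2 (q 0)"
    by (simp add: per is_ring_hom_prod[OF hom_ev2])
  finally have "\<mu> (ev2 ?N) = ev2 ?N" using nz by simp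
  hence "\<mu> (ev2 ?N) = \<iota> (\<zeta> ^ 0) * ev2 ?N" by (simp add: field_homD[OF \<iota>])
  then obtain D where D: "ev2 ?N = ev D * x ^ 0" using eigen_component[of ?N 0] m by blast
  have "ev2 ?N \<noteq> 0" using nz by (simp add: is_ring_hom_prod[OF hom_ev2])
  with D N that show ?thesis by (metis mult_1_right power_0 ev_eq_0_iff)
qed

lemma fractions: obtains P Q where "ev2 Q \<noteq> 0" "h = ev2 P / ev2 Q"
proof -
  let ?S = "{ev2 P / ev2 Q | P Q. ev2 Q \<noteq> 0}"
  have I: "a \<in> ?S" if "a = ev2 P / ev2 Q" "ev2 Q \<noteq> 0" for a P Q using that by blast
  have "is_subfield ?S" unfolding is_subfield_def
  proof safe
    show "\<exists>P Q. 1 = ev2 P / ev2 Q \<and> ev2 Q \<noteq> 0"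
      by (rule exI[of _ 1], rule exI[of _ 1]) (simp add: ev2D)
    fix P Q P' Q' assume nz: "ev2 Q \<noteq> 0" "ev2 Q' \<noteq> 0"
    show "\<exists>Pa Qa. ev2 P / ev2 Q - ev2 P' / ev2 Q' = ev2 Pa / ev2 Qa \<and> ev2 Qa \<noteq> 0"
      using nz by (intro exI[of _ "P * Q' - P' * Q"] exI[of _ "Q * Q'"]) (simp add: ev2D field_simps)
    show "\<exists>Pa Qa. ev2 P / ev2 Q * (ev2 P' / ev2 Q') = ev2 Pa / ev2 Qa \<and> ev2 Qa \<noteq> 0"
      using nz by (intro exI[of _ "P * P'"] exI[of _ "Q * Q'"]) (simp add: ev2D)
  next
    fix P Q assume nz: "ev2 Q \<noteq> 0"
    show "\<exists>Pa Qa. inverse (ev2 P / ev2 Q) = ev2 Pa / ev2 Qa \<and> ev2 Qa \<noteq> 0"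
    proof (cases "ev2 P = 0")
      case True thus ?thesis using nz by (intro exI[of _ P] exI[of _ Q]) simp
    next
      case False thus ?thesis by (intro exI[of _ Q] exI[of _ P]) simp
    qed
  qed
  moreover have "ev2 P \<in> ?S" for P by (rule I[of _ P 1]) (simp_all add: ev2D)
  hence "ev2 [:[:a:]:] \<in> ?S" "ev2 [:[:0,1:]:] \<in> ?S" "ev2 [:0,1:] \<in> ?S" for a by blast+
  hence "range \<iota> \<union> {w, x} \<subseteq> ?S" using \<iota> by (auto simp: hom_ev)
  ultimately show ?thesis using subfield_hull_induct[OF gen, of ?S h] that by blast
qed

lemma fractions_polynomial_denominator: obtains P D where "D \<noteq> 0" "h = ev2 P / ev D"
proof -
  obtain P Q where PQ: "ev2 Q \<noteq> 0" "h = ev2 P / ev2 Q" by (rule fractions)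
  obtain Q' D where D: "D \<noteq> 0" "ev2 Q * ev2 Q' = ev D" by (rule polynomial_multiple[OF PQ(1)])
  have "h = ev2 (P * Q') / ev D" using PQ D(1)
    by (simp add: ev2D flip: D(2)) (metis D ev_eq_0_iff mult_eq_0_iff nonzero_mult_divide_mult_cancel_right)
  thus ?thesis using that D(1) by blast
qed

text \<open>With a denominator that is fixed by the automorphism, the numerator is itself an eigenvector.\<close>

lemma eigenfunction:
  assumes "\<mu> h = \<iota> (\<zeta> ^ l) * h" "l < m"
  obtains P D where "D \<noteq> 0" "h = ev P / ev D * x ^ l"
proof -
  obtain P D where h: "D \<noteq> 0" "h = ev2 P / ev D" by (rule fractions_polynomial_denominator)
  hence "\<mu> (ev2 P) = \<iota> (\<zeta> ^ l) * ev2 P"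
    using assms(1) by (simp add: field_hom_divide[OF \<mu>(1)])
  then obtain q where "ev2 P = ev q * x ^ l" using eigen_component assms(2) by blast
  thus ?thesis using that[of D q] h by simp
qed

text \<open>A point of the curve over a larger field, with transcendental first coordinate, is an embedding of the
  function field. Elements of the kernel of \<open>k[w][x] \<rightarrow> K\<close> are multiples of the equation, so they vanish
  at the point; conversely a nonzero element has a nonzero multiple in \<open>k[w]\<close>, which does not vanish
  there. Hence fractions can be evaluated.\<close>

lemma extend_to_point:
  fixes \<kappa> :: "'k \<Rightarrow> 'l::field"
  assumes \<kappa>: "field_hom \<kappa>" and W: "W \<notin> range \<kappa>" and X: "X ^ m = evp \<kappa> W A"
  obtains \<Psi> where "field_hom \<Psi>" "\<And>a. \<Psi> (\<iota> a) = \<kappa> a" "\<Psi> w = W" "\<Psi> x = X"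
proof -
  define E where "E = evp (evp \<kappa> W) X"
  have hE1: "is_ring_hom (evp \<kappa> W)" using \<kappa> by (intro is_ring_hom_evp) simp
  have hE: "is_ring_hom E" unfolding E_def by (intro is_ring_hom_evp hE1)
  note ED = is_ring_homD[OF hE]
  have Erel: "E curve_poly = 0"
    using X by (simp add: curve_poly_def ED(6), simp add: E_def evp_monom[OF hE1] hE1 is_ring_homD(2)[OF hE1])
  have E0: "E P = 0" if "ev2 P = 0" for P
    using that by (auto simp: ev2_eq_0_iff ED Erel)
  have Eeq: "E P = E Q" if "ev2 P = ev2 Q" for P Q
    using E0[of "P - Q"] that by (simp add: ED ev2D)
  have Enz: "E Q \<noteq> 0" if nz: "ev2 Q \<noteq> 0" for Q
  proof -
    obtain Q' D where D: "D \<noteq> 0" "ev2 Q * ev2 Q' = ev D" by (rule polynomial_multiple[OF nz])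
    have "ev2 (Q * Q') = ev2 [:D:]" using D hom_ev by (simp add: ev2D)
    hence "E Q * E Q' = E [:D:]" using Eeq by (metis ED(4))
    also have "\<dots> \<noteq> 0" using D evp_eq_0_iff[OF \<kappa> W] by (simp add: E_def hE1)
    finally show ?thesis by auto
  qed
  define \<Psi> where "\<Psi> = (\<lambda>h. let (P, Q) = SOME (P, Q). ev2 Q \<noteq> 0 \<and> h = ev2 P / ev2 Q in E P / E Q)"
  have \<Psi>: "\<Psi> (ev2 P / ev2 Q) = E P / E Q" if Q: "ev2 Q \<noteq> 0" for P Q
  proof -
    define c where "c = (SOME (P', Q'). ev2 Q' \<noteq> 0 \<and> ev2 P / ev2 Q = ev2 P' / ev2 Q')"
    obtain P' Q' where c: "c = (P', Q')" by (cases c)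
    have "case c of (P', Q') \<Rightarrow> ev2 Q' \<noteq> 0 \<and> ev2 P / ev2 Q = ev2 P' / ev2 Q'"
      unfolding c_def by (rule someI[of _ "(P, Q)"]) (simp add: Q)
    hence *: "ev2 Q' \<noteq> 0" "ev2 P / ev2 Q = ev2 P' / ev2 Q'" by (simp_all add: c)
    hence "ev2 (P * Q') = ev2 (P' * Q)" using Q by (simp add: ev2D field_simps)
    hence "E P * E Q' = E P' * E Q" using Eeq by (metis ED(4))
    hence "E P / E Q = E P' / E Q'" using Enz[OF Q] Enz[OF *(1)] by (simp add: field_simps)
    moreover have "\<Psi> (ev2 P / ev2 Q) = E P' / E Q'"
      unfolding \<Psi>_def c_def[symmetric] c by simp
    ultimately show ?thesis by simp
  qed
  have \<Psi>1: "\<Psi> (ev2 P) = E P" for P using \<Psi>[of 1 P] by (simp add: ED ev2D)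
  have hom: "field_hom \<Psi>" unfolding field_hom_def
  proof (intro conjI allI)
    show "\<Psi> 1 = 1" using \<Psi>1[of 1] by (simp add: ED ev2D)
    fix a b
    obtain P Q where a: "ev2 Q \<noteq> 0" "a = ev2 P / ev2 Q" by (rule fractions)
    obtain P' Q' where b: "ev2 Q' \<noteq> 0" "b = ev2 P' / ev2 Q'" by (rule fractions)
    have QQ: "ev2 (Q * Q') \<noteq> 0" using a b by (simp add: ev2D)
    have "a + b = ev2 (P * Q' + P' * Q) / ev2 (Q * Q')" "a * b = ev2 (P * P') / ev2 (Q * Q')"
      using a(1) b(1) unfolding a(2) b(2) by (simp_all add: ev2D field_simps)
    hence sum: "\<Psi> (a + b) = E (P * Q' + P' * Q) / E (Q * Q')" and prod: "\<Psi> (a * b) = E (P * P') / E (Q * Q')"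
      using \<Psi>[OF QQ] by simp_all
    thus "\<Psi> (a + b) = \<Psi> a + \<Psi> b" "\<Psi> (a * b) = \<Psi> a * \<Psi> b"
      unfolding sum prod unfolding a(2) b(2) \<Psi>[OF a(1)] \<Psi>[OF b(1)]
      using Enz[OF a(1)] Enz[OF b(1)] by (simp_all add: ED field_simps)
  qed
  show ?thesis
  proof (rule that[OF hom])
    show "\<Psi> (\<iota> a) = \<kappa> a" for a
      using \<Psi>1[of "[:[:a:]:]"] \<iota> \<kappa> by (simp add: E_def hom_ev hE1)
    show "\<Psi> w = W" using \<Psi>1[of "[:[:0,1:]:]"] \<iota> \<kappa> by (simp add: E_def hom_ev hE1)
    show "\<Psi> x = X" using \<Psi>1[of "[:0,1:]"] \<iota> \<kappa> by (simp add: E_def hom_ev hE1)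
  qed
qed

end

section \<open>Kaehler differentials\<close>

definition derivation ::
  "('k::field \<Rightarrow> 'f::field) \<Rightarrow> ('f \<Rightarrow> 'v::ab_group_add \<Rightarrow> 'v) \<Rightarrow> ('f \<Rightarrow> 'v) \<Rightarrow> bool" where
  "derivation \<iota> sc d \<longleftrightarrow> (\<forall>a b. d (a + b) = d a + d b) \<and>
     (\<forall>a b. d (a * b) = sc a (d b) + sc b (d a)) \<and> (\<forall>c. d (\<iota> c) = 0)"

context vector_space
begin

lemma formal_eval_superset:
  assumes "finite S" "Poly_Mapping.keys u \<subseteq> S"
  shows "formal_eval scale d u = (\<Sum>g\<in>S. scale (Poly_Mapping.lookup u g) (d g))"
  unfolding formal_eval_def using assms
  by (intro sum.mono_neutral_left) (auto simp: in_keys_iff)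

lemma formal_eval_add: "formal_eval scale d (u + v) = formal_eval scale d u + formal_eval scale d v"
proof -
  let ?S = "Poly_Mapping.keys u \<union> Poly_Mapping.keys v"
  have "Poly_Mapping.keys (u + v) \<subseteq> ?S" by (rule Poly_Mapping.keys_add)
  thus ?thesis
    by (simp add: formal_eval_superset[of ?S] lookup_add scale_left_distrib sum.distrib)
qed

lemma formal_eval_single: "formal_eval scale d (Poly_Mapping.single g f) = scale f (d g)"
  by (subst formal_eval_superset[of "{g}"]) auto

lemma formal_eval_0: "formal_eval scale d 0 = 0"
  by (simp add: formal_eval_def)

lemma formal_eval_diff: "formal_eval scale d (u - v) = formal_eval scale d u - formal_eval scale d v"
  using formal_eval_add[of d "u - v" v] by simp

lemma lookup_free_scale:
  "Poly_Mapping.lookup (free_scale c u) g = c * Poly_Mapping.lookup u g" for c :: "'z::field"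
  by (simp add: free_scale_def Poly_Mapping.map.rep_eq when_def)

lemma formal_eval_free_scale: "formal_eval scale d (free_scale c u) = scale c (formal_eval scale d u)"
proof -
  have "Poly_Mapping.keys (free_scale c u) \<subseteq> Poly_Mapping.keys u"
    by (auto simp: in_keys_iff lookup_free_scale)
  thus ?thesis
    by (simp add: formal_eval_superset[of "Poly_Mapping.keys u"] lookup_free_scale scale_sum_right)
qed

lemma module_free_scale: "module (free_scale :: 'z::field \<Rightarrow> _)"
  by unfold_locales
    (auto intro!: poly_mapping_eqI simp: lookup_free_scale lookup_add algebra_simps)

lemma formal_eval_span_0:
  assumes "derivation \<iota> scale d" "u \<in> module.span free_scale (kaehler_relations \<iota>)"
  shows "formal_eval scale d u = 0"
  using assms(2)
proof (induction rule: module.span_induct_alt[OF module_free_scale, consumes 1])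
  case (2 c r u)
  have "formal_eval scale d r = 0"
    using 2(1) assms(1) unfolding kaehler_relations_def derivation_def
    by (auto simp: formal_eval_diff formal_eval_single)
  thus ?case by (simp add: formal_eval_add formal_eval_free_scale 2)
qed (simp add: formal_eval_0)

end

locale kaehler =
  fixes \<iota> :: "'k::field \<Rightarrow> 'f::field" and sc :: "'f \<Rightarrow> 'w::ab_group_add \<Rightarrow> 'w" and d :: "'f \<Rightarrow> 'w"
  assumes hom: "field_hom \<iota>" and kaehler: "is_kaehler \<iota> sc d"
begin

sublocale vector_space sc
  using kaehler by (simp add: is_kaehler_def)

lemma derivation: "derivation \<iota> sc d"
proof -
  have K: "formal_eval sc d u = 0" if "u \<in> kaehler_relations \<iota>" for u
    using kaehler that module.span_base[OF module_free_scale, of u "kaehler_relations \<iota>"]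
    unfolding is_kaehler_def by blast
  show ?thesis unfolding derivation_def
  proof (intro conjI allI)
    fix a b
    have "Poly_Mapping.single (a + b) 1 - Poly_Mapping.single a 1 - Poly_Mapping.single b 1
        \<in> kaehler_relations \<iota>"
      unfolding kaehler_relations_def by blast
    from K[OF this] show "d (a + b) = d a + d b"
      by (simp add: formal_eval_diff formal_eval_add formal_eval_single algebra_simps)
    have "Poly_Mapping.single (a * b) 1 - Poly_Mapping.single b a - Poly_Mapping.single a b
        \<in> kaehler_relations \<iota>"
      unfolding kaehler_relations_def by blast
    from K[OF this] show "d (a * b) = sc a (d b) + sc b (d a)"
      by (simp add: formal_eval_diff formal_eval_add formal_eval_single algebra_simps)
  next
    fix c
    have "Poly_Mapping.single (\<iota> c) 1 \<in> kaehler_relations \<iota>"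
      unfolding kaehler_relations_def by blast
    from K[OF this] show "d (\<iota> c) = 0" by (simp add: formal_eval_single)
  qed
qed

lemma d_add: "d (a + b) = d a + d b"
  and d_mult: "d (a * b) = sc a (d b) + sc b (d a)" and d_const [simp]: "d (\<iota> c) = 0"
  using derivation by (auto simp: derivation_def)

lemma d_0 [simp]: "d 0 = 0" and d_1 [simp]: "d 1 = 0"
  using d_const[of 0] d_const[of 1] by (auto simp: field_homD[OF hom])

lemma d_uminus: "d (- a) = - d a"
  using d_add[of a "- a"] by (simp add: eq_neg_iff_add_eq_0 add.commute)

lemma d_diff: "d (a - b) = d a - d b"
  using d_add[of a "- b"] by (simp add: d_uminus)

lemma d_const_mult: "d (\<iota> c * a) = sc (\<iota> c) (d a)"
  by (simp add: d_mult)

lemma d_power: "d (a ^ n) = sc (of_nat n * a ^ (n - 1)) (d a)"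
proof (induction n)
  case (Suc n)
  have "d (a ^ Suc n) = sc (a * (of_nat n * a ^ (n - 1)) + a ^ n) (d a)"
    by (simp add: d_mult Suc scale_left_distrib)
  also have "a * (of_nat n * a ^ (n - 1)) + a ^ n = of_nat (Suc n) * a ^ n"
    by (cases n) (simp_all add: algebra_simps)
  finally show ?case by simp
qed simp

lemma d_inverse: "d (inverse a) = sc (- (inverse a ^ 2)) (d a)"
proof (cases "a = 0")
  case False
  hence "0 = d (a * inverse a)" by simp
  hence "sc a (d (inverse a)) = - sc (inverse a) (d a)"
    by (simp add: d_mult eq_neg_iff_add_eq_0)
  hence "sc (inverse a) (sc a (d (inverse a))) = sc (inverse a) (sc (- inverse a) (d a))"
    by (simp add: scale_minus_left)
  thus ?thesis using False by (simp add: power2_eq_square)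
qed simp

lemma d_power_int: "a \<noteq> 0 \<Longrightarrow> d (a powi n) = sc (of_int n * a powi (n - 1)) (d a)"
proof (cases n)
  case (nonneg k)
  assume a: "a \<noteq> 0"
  show ?thesis
  proof (cases k)
    case (Suc j)
    hence "int k - 1 = int j" by simp
    thus ?thesis using d_power[of a "Suc j"] Suc nonneg
      by (simp del: of_nat_Suc power_Suc add: power_int_def nat_diff_distrib)
  qed (simp add: nonneg)
next
  case (neg k)
  assume a: "a \<noteq> 0"
  have "- int (Suc k) - 1 = - int (k + 2)" by simp
  hence e: "a powi (n - 1) = inverse (a ^ (k + 2))"
    by (simp only: neg \<open>- int (Suc k) - 1 = - int (k + 2)\<close> power_int_minus power_int_of_nat)
  have "a powi n = inverse (a ^ Suc k)"
    by (simp only: neg power_int_minus power_int_of_nat)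
  hence "d (a powi n) = sc (- (inverse (a ^ Suc k) ^ 2) * (of_nat (Suc k) * a ^ k)) (d a)"
    by (simp add: d_inverse d_power del: power_Suc of_nat_Suc)
  also have "- (inverse (a ^ Suc k) ^ 2) * (of_nat (Suc k) * a ^ k) = of_int n * a powi (n - 1)"
  proof -
    have "(a ^ Suc k)\<^sup>2 = a ^ (k + 2) * a ^ k"
      by (simp add: power2_eq_square flip: power_add)
    hence "inverse (a ^ Suc k) ^ 2 * a ^ k = inverse (a ^ (k + 2))"
      using a by (simp add: power_inverse del: power_Suc)
    thus ?thesis unfolding e by (simp add: neg mult_ac del: power_Suc of_nat_Suc)
  qed
  finally show ?thesis .
qed

lemma differential_sum:
  obtains u where "\<omega> = (\<Sum>g\<in>Poly_Mapping.keys u. sc (Poly_Mapping.lookup u g) (d g))"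
  using kaehler unfolding is_kaehler_def surj_def formal_eval_def by blast

lemma additive_sum:
  fixes T :: "'w \<Rightarrow> 'v::ab_group_add"
  assumes "\<And>u v. T (u + v) = T u + T v"
  shows "T (sum f S) = (\<Sum>i\<in>S. T (f i))"
proof -
  have "T 0 = 0" using assms[of 0 0] by simp
  thus ?thesis by (induction S rule: infinite_finite_induct) (auto simp: assms)
qed

lemma additive_unique:
  fixes T T' :: "'w \<Rightarrow> 'v::ab_group_add"
  assumes "\<And>u v. T (u + v) = T u + T v" "\<And>u v. T' (u + v) = T' u + T' v"
    "\<And>f g. T (sc f (d g)) = T' (sc f (d g))"
  shows "T = T'"
proof
  fix \<omega>
  obtain u where "\<omega> = (\<Sum>g\<in>Poly_Mapping.keys u. sc (Poly_Mapping.lookup u g) (d g))"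
    by (rule differential_sum)
  thus "T \<omega> = T' \<omega>" by (simp add: additive_sum[of T] additive_sum[of T'] assms)
qed

text \<open>The target is a vector space over the function field through an arbitrary scalar action. This allows
  the scalars to act through an automorphism, for pullbacks, or through an embedding into Laurent series.\<close>

lemma universal_property:
  fixes sc' :: "'f \<Rightarrow> 'v::ab_group_add \<Rightarrow> 'v"
  assumes V: "vector_space sc'" and d': "derivation \<iota> sc' d'"
  obtains T where "\<And>u v. T (u + v) = T u + T v" "\<And>f g. T (sc f (d g)) = sc' f (d' g)"
proof -
  interpret V: vector_space sc' by (rule V)
  define r where "r = (\<lambda>\<omega>. SOME u. formal_eval sc d u = \<omega>)"
  have r: "formal_eval sc d (r \<omega>) = \<omega>" for \<omega>
  proof -
    have "\<exists>u. formal_eval sc d u = \<omega>"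
      using kaehler unfolding is_kaehler_def by (metis surjD)
    thus ?thesis unfolding r_def by (rule someI_ex)
  qed
  have ker: "formal_eval sc' d' u = formal_eval sc' d' v" if "formal_eval sc d u = formal_eval sc d v" for u v
  proof -
    have "formal_eval sc d (u - v) = 0" using that by (simp add: formal_eval_diff)
    hence "u - v \<in> module.span free_scale (kaehler_relations \<iota>)"
      using kaehler unfolding is_kaehler_def by blast
    hence "formal_eval sc' d' (u - v) = 0" using V.formal_eval_span_0 d' by blast
    thus ?thesis by (simp add: V.formal_eval_diff)
  qed
  show ?thesis
  proof (rule that[of "\<lambda>\<omega>. formal_eval sc' d' (r \<omega>)"])
    show "formal_eval sc' d' (r (u + v)) = formal_eval sc' d' (r u) + formal_eval sc' d' (r v)" for u v
      unfolding V.formal_eval_add[symmetric] by (rule ker) (simp add: formal_eval_add r)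
    show "formal_eval sc' d' (r (sc f (d g))) = sc' f (d' g)" for f g
      unfolding V.formal_eval_single[symmetric] by (rule ker) (simp add: formal_eval_single r)
  qed
qed

lemma pullback:
  assumes \<phi>: "field_hom \<phi>" "\<And>a. \<phi> (\<iota> a) = \<iota> a"
  shows pullback_add: "pullback sc d \<phi> (u + v) = pullback sc d \<phi> u + pullback sc d \<phi> v"
    and pullback_scale: "pullback sc d \<phi> (sc f (d g)) = sc (\<phi> f) (d (\<phi> g))"
proof -
  have V: "vector_space (\<lambda>f. sc (\<phi> f))"
    by unfold_locales (simp_all add: field_homD[OF \<phi>(1)] scale_left_distrib scale_right_distrib)
  have D: "derivation \<iota> (\<lambda>f. sc (\<phi> f)) (\<lambda>g. d (\<phi> g))"
    unfolding derivation_def by (simp add: field_homD[OF \<phi>(1)] d_add d_mult \<phi>(2))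
  obtain T where T: "\<And>u v. T (u + v) = T u + T v" "\<And>f g. T (sc f (d g)) = sc (\<phi> f) (d (\<phi> g))"
    by (rule universal_property[OF V D]) blast
  have "pullback sc d \<phi> = T" unfolding pullback_def
  proof (rule the_equality)
    fix T' assume "(\<forall>u v. T' (u + v) = T' u + T' v) \<and> (\<forall>f g. T' (sc f (d g)) = sc (\<phi> f) (d (\<phi> g)))"
    thus "T' = T" by (intro additive_unique) (simp_all add: T)
  qed (simp add: T)
  thus "pullback sc d \<phi> (u + v) = pullback sc d \<phi> u + pullback sc d \<phi> v"
    "pullback sc d \<phi> (sc f (d g)) = sc (\<phi> f) (d (\<phi> g))" by (simp_all add: T)
qed

text \<open>The functions g for which dg is a multiple of dx form a subfield, by the sum, product and inverse rules.\<close>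

lemma rank_one:
  assumes gen: "is_subfield hull (range \<iota> \<union> G) = UNIV"
    and G: "\<And>g. g \<in> G \<Longrightarrow> \<exists>f. d g = sc f (d x)"
  obtains h where "\<omega> = sc h (d x)"
proof -
  let ?S = "{g. \<exists>f. d g = sc f (d x)}"
  have I: "g \<in> ?S" if "d g = sc f (d x)" for f g using that by blast
  have "is_subfield ?S" unfolding is_subfield_def
  proof (intro conjI ballI)
    show "1 \<in> ?S" by (rule I[of _ 0]) simp
    fix a assume "a \<in> ?S"
    then obtain f where f: "d a = sc f (d x)" by blast
    show "inverse a \<in> ?S" by (rule I[of _ "- (inverse a ^ 2) * f"]) (simp add: d_inverse f)
    fix b assume "b \<in> ?S"
    then obtain g where g: "d b = sc g (d x)" by blast
    show "a - b \<in> ?S" by (rule I[of _ "f - g"]) (simp add: d_diff f g scale_left_diff_distrib)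
    show "a * b \<in> ?S"
      by (rule I[of _ "a * g + b * f"]) (simp add: d_mult f g scale_left_distrib)
  qed
  moreover have "range \<iota> \<union> G \<subseteq> ?S" using G I[of _ 0] by auto
  ultimately have all: "\<exists>f. d g = sc f (d x)" for g
    using subfield_hull_induct[OF gen, of ?S g] by blast
  then obtain c where c: "\<And>g. d g = sc (c g) (d x)" by metis
  obtain u where "\<omega> = (\<Sum>g\<in>Poly_Mapping.keys u. sc (Poly_Mapping.lookup u g) (d g))"
    by (rule differential_sum)
  also have "\<dots> = sc (\<Sum>g\<in>Poly_Mapping.keys u. Poly_Mapping.lookup u g * c g) (d x)"
    unfolding scale_sum_left by (intro sum.cong refl) (metis c scale_scale)
  finally show ?thesis using that by blast
qed

lemma regular_atI: "f \<in> O' \<Longrightarrow> g \<in> O' \<Longrightarrow> regular_at sc d O' (sc f (d g))"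
  unfolding regular_at_def by (intro exI[of _ "[(f, g)]"]) simp

end

section \<open>Laurent series\<close>

text \<open>Changing the n-th coefficient of g by c changes that of \<open>g^m\<close> by \<open>m g(0)^(m-1) c\<close>, because
  \<open>g^m - h^m\<close> is divisible by \<open>g - h\<close> and the quotient has constant term \<open>m h(0)^(m-1)\<close>. This is the
  step of the Newton iteration for roots.\<close>

lemma fps_power_nth_agree:
  fixes g h :: "'a::comm_ring_1 fps"
  assumes "\<And>i. i < n \<Longrightarrow> g $ i = h $ i" "n > 0"
  shows "(g ^ m) $ n = (h ^ m) $ n + of_nat m * (h $ 0) ^ (m - 1) * (g $ n - h $ n)"
    and "i < n \<Longrightarrow> (g ^ m) $ i = (h ^ m) $ i"
proof -
  have "\<exists>r. g - h = fps_X ^ n * r"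
    using assms(1) by (intro exI[of _ "fps_shift n (g - h)"] fps_ext)
      (simp add: fps_X_power_mult_nth)
  then obtain r where r: "g - h = fps_X ^ n * r" by blast
  \<comment> \<open>The cofactor of \<open>g - h\<close> in \<open>g^m - h^m\<close>.\<close>
  define S where "S = (\<Sum>i<m. h ^ (m - Suc i) * g ^ i)"
  have eq: "g ^ m - h ^ m = fps_X ^ n * (r * S)"
    unfolding S_def power_diff_sumr2 r by (simp add: mult.assoc)
  have g0: "g $ 0 = h $ 0" using assms by simp
  have r0: "r $ 0 = g $ n - h $ n"
    using arg_cong[OF r, of "\<lambda>f. f $ n"] by (simp add: fps_X_power_mult_nth)
  have "S $ 0 = (\<Sum>i<m. (h $ 0) ^ (m - 1))"
    unfolding S_def fps_sum_nth
    by (intro sum.cong refl) (simp add: fps_power_zeroth g0 flip: power_add)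
  hence S0: "S $ 0 = of_nat m * (h $ 0) ^ (m - 1)" by simp
  have "(g ^ m - h ^ m) $ n = r $ 0 * S $ 0" by (simp add: eq fps_X_power_mult_nth)
  thus "(g ^ m) $ n = (h ^ m) $ n + of_nat m * (h $ 0) ^ (m - 1) * (g $ n - h $ n)"
    by (simp add: r0 S0 algebra_simps)
  have "(g ^ m - h ^ m) $ i = 0" if "i < n"
    using that by (simp add: eq fps_X_power_mult_nth)
  thus "i < n \<Longrightarrow> (g ^ m) $ i = (h ^ m) $ i" by simp
qed

text \<open>The coefficients are found one at a time; each is the solution of a linear equation with nonzero slope.\<close>

lemma fps_root_exists:
  fixes f :: "'a::alg_closed_field fps"
  assumes m: "m > 0" "of_nat m \<noteq> (0::'a)" and f: "f $ 0 \<noteq> 0"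
  obtains g where "g ^ m = f"
proof -
  obtain a where a: "a ^ m = f $ 0" using nth_root_exists m(1) by blast
  with f m have nz: "a \<noteq> 0" by (metis power_0_left less_irrefl)
  \<comment> \<open>A root up to order n; passing from n to n + 1 leaves the coefficients up to the n-th unchanged.\<close>
  define P where "P = (\<lambda>n g. g $ 0 = a \<and> (\<forall>i\<le>n. (g ^ m) $ i = f $ i))"
  have "\<exists>G. \<forall>n. P n (G n) \<and> (\<forall>i\<le>n. G (Suc n) $ i = G n $ i)"
  proof (rule dependent_nat_choice)
    show "\<exists>g. P 0 g"
      by (rule exI[of _ "fps_const a"]) (simp add: P_def fps_power_zeroth a)
    fix g n assume g: "P n g"
    define c where "c = (f $ Suc n - (g ^ m) $ Suc n) / (of_nat m * a ^ (m - 1))"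
    define g' where "g' = g + fps_const c * fps_X ^ Suc n"
    have ag: "g' $ i = g $ i" if "i < Suc n" for i
      using that by (simp add: g'_def del: power_Suc)
    have "g' $ Suc n - g $ Suc n = c" by (simp add: g'_def del: power_Suc)
    hence "(g' ^ m) $ Suc n = f $ Suc n"
      using fps_power_nth_agree(1)[of "Suc n" g' g m] ag g m nz by (simp add: P_def c_def)
    moreover have "(g' ^ m) $ i = f $ i" if "i \<le> n" for i
      using fps_power_nth_agree(2)[of "Suc n" g' g i m] ag g that by (simp add: P_def)
    ultimately have "P (Suc n) g'" using g ag[of 0] by (auto simp: P_def le_Suc_eq)
    thus "\<exists>y. P (Suc n) y \<and> (\<forall>i\<le>n. y $ i = g $ i)" using ag by auto
  qed
  then obtain G where G: "\<And>n. P n (G n)" "\<And>n i. i \<le> n \<Longrightarrow> G (Suc n) $ i = G n $ i" by blast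
  have stable: "G j $ i = G i $ i" if "i \<le> j" for i j
    using that by (induction j rule: dec_induct) (auto simp: G(2))
  define g where "g = Abs_fps (\<lambda>n. G n $ n)"
  have "(g ^ m) $ n = f $ n" for n
  proof -
    have "g $ i = G n $ i" if "i < Suc n" for i
      using stable[of i n] that by (simp add: g_def)
    with fps_power_nth_agree(2)[of "Suc n" g "G n" n m] G(1)[of n] show ?thesis by (simp add: P_def)
  qed
  hence "g ^ m = f" by (intro fps_ext)
  thus ?thesis by (rule that)
qed

text \<open>A series whose order is a multiple of m is the m-th power of a monomial times a unit, and units have roots.\<close>

lemma fls_root_exists:
  fixes F :: "'a::alg_closed_field fls"
  assumes m: "m > 0" "of_nat m \<noteq> (0::'a)" and F: "F \<noteq> 0" "int m dvd fls_subdegree F"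
  obtains X where "X ^ m = F"
proof -
  obtain N where N: "fls_subdegree F = int m * N" using F(2) by blast
  let ?u = "fls_base_factor_to_fps F"
  have "?u $ 0 \<noteq> 0" using F by simp
  then obtain g where g: "g ^ m = ?u" using fps_root_exists m by blast
  have "(fps_to_fls g * fls_X_intpow N) ^ m = fps_to_fls ?u * fls_X_intpow N ^ m"
    by (simp only: power_mult_distrib g fps_to_fls_power[symmetric])
  also have "fls_X_intpow N ^ m = (fls_X_intpow (fls_subdegree F) :: 'a fls)"
    unfolding N by (induction m) (simp_all add: algebra_simps fls_X_intpow_times_fls_X_intpow)
  also have "fps_to_fls ?u * fls_X_intpow (fls_subdegree F) = F"
    by (simp only: fps_to_fls_base_factor_to_fps flip: fls_base_factor_X_power_decompose(1))
  finally show ?thesis by (rule that)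
qed

lemma field_hom_fls_const: "field_hom (fls_const :: 'a::field \<Rightarrow> 'a fls)"
  by (simp add: field_hom_def fls_plus_const)

lemma fls_subdegree_add_ge_0:
  "fls_subdegree F \<ge> 0 \<Longrightarrow> fls_subdegree G \<ge> 0 \<Longrightarrow> fls_subdegree (F + G) \<ge> 0"
  using fls_plus_subdegree[of F G] by (cases "F + G = 0") auto

lemma fls_subdegree_mult_ge_0:
  "fls_subdegree F \<ge> 0 \<Longrightarrow> fls_subdegree G \<ge> 0 \<Longrightarrow> fls_subdegree (F * G) \<ge> 0"
  for F G :: "'a::field fls"
  by (cases "F = 0 \<or> G = 0") auto

lemma fls_subdegree_deriv_ge_0:
  assumes "fls_subdegree F \<ge> 0"
  shows "fls_subdegree (fls_deriv F) \<ge> 0"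
proof (rule fls_subdegree_ge0I)
  fix k :: int assume "k < 0"
  thus "fls_nth (fls_deriv F) k = 0" using assms by (cases "k = - 1") simp_all
qed

abbreviation evL :: "'a::field fls \<Rightarrow> 'a poly \<Rightarrow> 'a fls" where
  "evL \<equiv> evp fls_const"

lemma hom_fls_const: "is_ring_hom (fls_const :: 'a::field \<Rightarrow> 'a fls)"
  by (simp add: field_hom_fls_const)

lemmas evLD = evpD[OF hom_fls_const]
lemmas evL_pCons = evp_pCons[OF hom_fls_const]

lemma evL_subdegree_ge_0: "fls_subdegree W \<ge> 0 \<Longrightarrow> fls_subdegree (evL W P) \<ge> 0"
  by (induction P) (simp_all add: evL_pCons fls_subdegree_add_ge_0 fls_subdegree_mult_ge_0)

lemma evL_deriv: "fls_deriv (evL W P) = evL W (pderiv P) * fls_deriv W"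
proof (induction P)
  case (pCons a P)
  have "evL W (pderiv (pCons a P)) = evL W P + W * evL W (pderiv P)"
    by (simp add: pderiv_pCons evLD evL_pCons)
  thus ?case by (simp add: evL_pCons pCons algebra_simps)
qed simp

lemma evL_subdegree_pole:
  assumes "fls_subdegree W < 0" "P \<noteq> 0"
  shows "evL W P \<noteq> 0 \<and> fls_subdegree (evL W P) = int (degree P) * fls_subdegree W"
  using assms(2)
proof (induction P)
  case (pCons a P)
  have W: "W \<noteq> 0" using assms by auto
  show ?case
  proof (cases "P = 0")
    case True
    thus ?thesis using pCons by (simp add: evL_pCons)
  next
    case False
    hence IH: "evL W P \<noteq> 0" "fls_subdegree (evL W P) = int (degree P) * fls_subdegree W"
      using pCons by auto
    hence s: "fls_subdegree (W * evL W P) = int (Suc (degree P)) * fls_subdegree W"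
      using W by (simp add: algebra_simps)
    hence neg: "fls_subdegree (W * evL W P) < fls_subdegree (fls_const a)"
      using assms(1) by (simp add: mult_pos_neg)
    have "fls_subdegree (evL W (pCons a P)) = fls_subdegree (W * evL W P)"
      unfolding evL_pCons using neg W IH by (intro fls_subdegree_add_eq2) auto
    thus ?thesis using s neg False by auto
  qed
qed simp

text \<open>The value is a power series in \<open>t^m\<close>. This is the divisibility required for an m-th root.\<close>

lemma evL_X_power_subdegree:
  assumes "m > 0"
  shows "int m dvd fls_subdegree (evL (fls_X ^ m) P)"
proof (induction P)
  case (pCons a P)
  let ?E = "evL (fls_X ^ m) P"
  have ge: "fls_subdegree ?E \<ge> 0" by (rule evL_subdegree_ge_0) simp
  show ?case
  proof (cases "?E = 0")
    case True thus ?thesis by (simp add: evL_pCons)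
  next
    case nz: False
    hence s: "fls_subdegree (fls_X ^ m * ?E) = int m + fls_subdegree ?E" by simp
    show ?thesis
    proof (cases "a = 0")
      case True thus ?thesis using s pCons(2) by (simp add: evL_pCons)
    next
      case False
      have "fls_subdegree (evL (fls_X ^ m) (pCons a P)) = fls_subdegree (fls_const a)"
        unfolding evL_pCons using False s ge assms by (intro fls_subdegree_add_eq1) auto
      thus ?thesis by simp
    qed
  qed
qed simp

lemma laurent_place:
  assumes \<Psi>: "field_hom \<Psi>" "\<And>a. \<Psi> (\<iota> a) = fls_const a"
    and y: "fls_subdegree (\<Psi> y) < 0"
  shows "is_place \<iota> {h. fls_subdegree (\<Psi> h) \<ge> 0}"
  unfolding is_place_def
proof (intro conjI ballI allI)
  show "range \<iota> \<subseteq> {h. fls_subdegree (\<Psi> h) \<ge> 0}" by (auto simp: \<Psi>(2))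
  show "{h. fls_subdegree (\<Psi> h) \<ge> 0} \<noteq> UNIV" using y by (auto simp: set_eq_iff intro!: exI[of _ y])
  fix a b assume "a \<in> {h. fls_subdegree (\<Psi> h) \<ge> 0}" "b \<in> {h. fls_subdegree (\<Psi> h) \<ge> 0}"
  thus "a - b \<in> {h. fls_subdegree (\<Psi> h) \<ge> 0}" "a * b \<in> {h. fls_subdegree (\<Psi> h) \<ge> 0}"
    using fls_subdegree_add_ge_0[of "\<Psi> a" "- \<Psi> b"]
    by (simp_all add: field_homD(4,6)[OF \<Psi>(1)] fls_subdegree_mult_ge_0)
next
  fix a
  show "a \<in> {h. fls_subdegree (\<Psi> h) \<ge> 0} \<or> inverse a \<in> {h. fls_subdegree (\<Psi> h) \<ge> 0}"
    by (cases "\<Psi> a = 0") (simp_all add: field_hom_inverse[OF \<Psi>(1)] linear)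
qed

lemma (in kaehler) laurent_differential:
  assumes \<Psi>: "field_hom \<Psi>" "\<And>a. \<Psi> (\<iota> a) = fls_const a"
  obtains T where "\<And>u v. T (u + v) = T u + T v" "\<And>f g. T (sc f (d g)) = \<Psi> f * fls_deriv (\<Psi> g)"
proof -
  have V: "vector_space (\<lambda>f v. \<Psi> f * v)"
    by unfold_locales (simp_all add: field_homD[OF \<Psi>(1)] algebra_simps)
  have D: "derivation \<iota> (\<lambda>f v. \<Psi> f * v) (\<lambda>g. fls_deriv (\<Psi> g))"
    unfolding derivation_def by (simp add: field_homD[OF \<Psi>(1)] \<Psi>(2) algebra_simps)
  show ?thesis by (rule universal_property[OF V D]) (rule that)
qed

text \<open>The map \<open>f dg \<mapsto> f g'\<close> to Laurent series is well defined by the universal property, and power series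
  are stable under derivation.\<close>

lemma (in kaehler) regular_laurent:
  assumes \<Psi>: "field_hom \<Psi>" "\<And>a. \<Psi> (\<iota> a) = fls_const a"
    and reg: "regular_at sc d {h. fls_subdegree (\<Psi> h) \<ge> 0} (sc h (d x))"
  shows "fls_subdegree (\<Psi> h * fls_deriv (\<Psi> x)) \<ge> 0"
proof -
  obtain T where T: "\<And>u v. T (u + v) = T u + T v" "\<And>f g. T (sc f (d g)) = \<Psi> f * fls_deriv (\<Psi> g)"
    by (rule laurent_differential[OF \<Psi>]) blast
  let ?O = "{h. fls_subdegree (\<Psi> h) \<ge> 0}"
  obtain fgs where fgs: "set fgs \<subseteq> ?O \<times> ?O" "sc h (d x) = (\<Sum>(f, g)\<leftarrow>fgs. sc f (d g))"
    using reg unfolding regular_at_def by blast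
  have "T 0 = 0" using T(1)[of 0 0] by (metis add_0 add_right_cancel)
  hence "fls_subdegree (T (\<Sum>(f, g)\<leftarrow>fgs. sc f (d g))) \<ge> 0" using fgs(1)
    by (induction fgs)
      (auto simp: T intro!: fls_subdegree_add_ge_0 fls_subdegree_mult_ge_0 fls_subdegree_deriv_ge_0)
  thus ?thesis by (simp add: T flip: fgs(2))
qed

section \<open>Bounds for regular differentials\<close>

text \<open>A constant derivative of A makes the affine curve smooth with dx free of zeros: the last
  assumption is the differential of the equation. Coprimality of the degree and m gives
  total ramification at infinity.\<close>

locale separable_superelliptic = superelliptic +
  fixes sc :: "'b \<Rightarrow> 'w::ab_group_add \<Rightarrow> 'w" and d :: "'b \<Rightarrow> 'w" and a0 :: 'a
  assumes kaehler: "is_kaehler \<iota> sc d"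
    and A': "pderiv A = [:a0:]" "a0 \<noteq> 0"
    and degA: "degree A \<ge> 2" "coprime (degree A) m"
    and dw: "sc (\<iota> a0) (d w) = sc (of_nat m * x ^ (m - 1)) (d x)"
begin

sublocale kaehler \<iota> sc d
  using \<iota> kaehler by unfold_locales

abbreviation n :: nat where "n \<equiv> degree A"

text \<open>A Laurent series W for w determines x up to a root of unity as an m-th root of A(W). The
  last conclusion, the derivative of \<open>X^m = A(W)\<close>, gives the order of dx along the branch.\<close>

lemma laurent_branch:
  assumes W: "W \<notin> range fls_const" and F: "int m dvd fls_subdegree (evL W A)"
  obtains \<Psi> X where "field_hom \<Psi>" "\<And>a. \<Psi> (\<iota> a) = fls_const a" "\<Psi> w = W" "\<Psi> x = X"
    "X ^ m = evL W A" "X \<noteq> 0"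
    "of_nat m * X ^ (m - 1) * fls_deriv X = fls_const a0 * fls_deriv W"
proof -
  have nz: "evL W A \<noteq> 0" using evp_eq_0_iff[OF field_hom_fls_const W] A by simp
  obtain X where X: "X ^ m = evL W A" using fls_root_exists[OF m nz F] .
  have X0: "X \<noteq> 0" using X nz m by (metis power_0_left less_irrefl)
  obtain \<Psi> where \<Psi>: "field_hom \<Psi>" "\<And>a. \<Psi> (\<iota> a) = fls_const a" "\<Psi> w = W" "\<Psi> x = X"
    by (rule extend_to_point[OF field_hom_fls_const W X]) blast
  have "fls_deriv (X ^ m) = fls_deriv (evL W A)" by (simp add: X)
  hence "of_nat m * X ^ (m - 1) * fls_deriv X = fls_const a0 * fls_deriv W"
    unfolding evL_deriv fls_deriv_power by (simp add: A' field_hom_fls_const)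
  thus ?thesis using that \<Psi> X X0 by blast
qed

lemma \<Psi>_ev:
  assumes "field_hom \<Psi>" "\<And>a. \<Psi> (\<iota> a) = fls_const a"
  shows "\<Psi> (ev P) = evL (\<Psi> w) P"
  using evp_hom_comp[of \<Psi> \<iota> w P] assms \<iota> by simp

lemma m_nz_fls: "of_nat m \<noteq> (0::'a fls)"
  using m(2) by (metis fls_const_eq_0_iff field_homD(8) field_hom_fls_const)

text \<open>Along \<open>w = b + t^m\<close> the order of dx is \<open>(m - 1)(1 - \<nu>)\<close>, where \<open>\<nu> \<ge> 0\<close> is the order of x. A pole at b
  contributes order at most \<open>-m\<close>, which neither dx nor \<open>x^l\<close> can compensate. The ramified
  parameter \<open>t^m\<close> treats the branch points \<open>A(b) = 0\<close> and the other points alike.\<close>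

lemma regular_no_pole:
  assumes reg: "\<And>O'. is_place \<iota> O' \<Longrightarrow> regular_at sc d O' (sc (ev P / ev D * x ^ l) (d x))"
    and D: "D \<noteq> 0" "poly D b = 0" and l: "l < m - 1"
  shows "poly P b = 0"
proof (rule ccontr)
  assume Pb: "poly P b \<noteq> 0"
  define W where "W = fls_const b + fls_X ^ m"
  have W_ge: "fls_subdegree W \<ge> 0"
    unfolding W_def by (intro fls_subdegree_add_ge_0) auto
  have W: "W \<notin> range fls_const"
  proof
    assume "W \<in> range fls_const"
    then obtain c where "W = fls_const c" by auto
    hence "fls_X ^ m = fls_const c - fls_const b" by (metis W_def add_diff_cancel_left')
    hence "fls_X ^ m = fls_const (c - b)" by (simp add: field_homD(6)[OF field_hom_fls_const])
    hence "int m = 0" by (metis fls_const_subdegree fls_subdegree_fls_X_pow)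
    thus False using m by simp
  qed
  have "evL W A = evL (fls_X ^ m) (pcompose A [:b, 1:])"
    by (simp add: evp_pcompose evL_pCons W_def field_hom_fls_const)
  hence "int m dvd fls_subdegree (evL W A)" using evL_X_power_subdegree m by metis
  from W this obtain \<Psi> X where \<Psi>: "field_hom \<Psi>" "\<And>a. \<Psi> (\<iota> a) = fls_const a" "\<Psi> w = W" "\<Psi> x = X"
    and X: "X ^ m = evL W A" "X \<noteq> 0"
    and X': "of_nat m * X ^ (m - 1) * fls_deriv X = fls_const a0 * fls_deriv W"
    by (rule laurent_branch) blast
  let ?\<nu> = "fls_subdegree X"
  have W': "fls_deriv W = of_nat m * fls_X ^ (m - 1)" by (simp add: W_def fls_deriv_X_power)
  have X'1: "X ^ (m - 1) * fls_deriv X = fls_const a0 * fls_X ^ (m - 1)"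
  proof -
    have "of_nat m * (X ^ (m - 1) * fls_deriv X) = of_nat m * (fls_const a0 * fls_X ^ (m - 1))"
      using X' unfolding W' by (simp add: mult_ac)
    thus ?thesis using m_nz_fls by simp
  qed
  moreover have "fls_const a0 * fls_X ^ (m - 1) \<noteq> (0 :: 'a fls)" using A' by simp
  ultimately have X'nz: "fls_deriv X \<noteq> 0" by auto
  have "fls_subdegree (X ^ (m - 1) * fls_deriv X) = fls_subdegree (fls_const a0 * fls_X ^ (m - 1) :: 'a fls)"
    by (simp only: X'1)
  hence ord_X': "int (m - 1) * ?\<nu> + fls_subdegree (fls_deriv X) = int (m - 1)"
    using X(2) X'nz A' by (simp add: fls_subdegree_pow)
  have "int m * ?\<nu> = fls_subdegree (evL W A)" by (simp add: fls_subdegree_pow flip: X(1))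
  also have "\<dots> \<ge> 0" using W_ge by (rule evL_subdegree_ge_0)
  finally have \<nu>: "?\<nu> \<ge> 0" using m by (simp add: zero_le_mult_iff)
  obtain D1 where D1: "D = [:-b, 1:] * D1" using D(2) poly_eq_0_iff_dvd by blast
  have "poly (P - [:poly P b:]) b = 0" by simp
  then obtain P1 where P1: "P - [:poly P b:] = [:-b, 1:] * P1" using poly_eq_0_iff_dvd by blast
  have t: "evL W [:-b, 1:] = fls_X ^ m"
    by (simp add: evL_pCons W_def field_homD[OF field_hom_fls_const])
  have D_nz: "evL W D \<noteq> 0" using evp_eq_0_iff[OF field_hom_fls_const W] D by simp
  have "evL W D = fls_X ^ m * evL W D1" unfolding D1 evLD(4) t ..
  moreover from this D_nz have "evL W D1 \<noteq> 0" by auto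
  ultimately have ord_D: "fls_subdegree (evL W D) \<ge> int m"
    using evL_subdegree_ge_0[OF W_ge, of D1] by simp
  have "P = [:poly P b:] + [:-b, 1:] * P1" by (metis P1 add.commute diff_add_cancel)
  hence "evL W P = evL W [:poly P b:] + evL W [:-b, 1:] * evL W P1" by (metis evLD(3,4))
  hence P_eq: "evL W P = fls_const (poly P b) + fls_X ^ m * evL W P1"
    unfolding t by (simp add: field_hom_fls_const)
  have ord_P: "evL W P \<noteq> 0" "fls_subdegree (evL W P) = 0"
  proof -
    show nz: "evL W P \<noteq> 0" using evp_eq_0_iff[OF field_hom_fls_const W, of P] Pb by auto
    show "fls_subdegree (evL W P) = 0"
    proof (cases "evL W P1 = 0")
      case False
      hence "fls_subdegree (fls_X ^ m * evL W P1) > 0"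
        using evL_subdegree_ge_0[OF W_ge, of P1] m by simp
      thus ?thesis unfolding P_eq using Pb by (subst fls_subdegree_add_eq1) simp_all
    qed (simp add: P_eq)
  qed
  have "is_place \<iota> {h. fls_subdegree (\<Psi> h) \<ge> 0}"
  proof (rule laurent_place[OF \<Psi>(1,2)])
    show "fls_subdegree (\<Psi> (inverse (ev [:-b, 1:]))) < 0"
      using m by (simp only: \<Psi>_ev[OF \<Psi>(1,2)] field_hom_inverse[OF \<Psi>(1)] \<Psi>(3) t) simp
  qed
  from regular_laurent[OF \<Psi>(1,2) reg[OF this]]
  have "0 \<le> fls_subdegree (evL W P / evL W D * X ^ l * fls_deriv X)"
    by (simp add: \<Psi> field_homD[OF \<Psi>(1)] field_hom_divide[OF \<Psi>(1)] \<Psi>_ev[OF \<Psi>(1,2)])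
  also have "\<dots> = - fls_subdegree (evL W D) + int l * ?\<nu> + fls_subdegree (fls_deriv X)"
    using X'nz D_nz ord_P X(2) by (simp add: divide_inverse fls_subdegree_pow)
  also have "fls_subdegree (fls_deriv X) = int (m - 1) - int (m - 1) * ?\<nu>" using ord_X' by simp
  finally have "0 \<le> - int m + int (m - 1) - (int (m - 1) - int l) * ?\<nu>"
    using ord_D by (simp add: algebra_simps)
  moreover have "(int (m - 1) - int l) * ?\<nu> \<ge> 0" using \<nu> l by simp
  ultimately show False using m by simp
qed

text \<open>Along \<open>w = t^(-m)\<close> the order of x is \<open>-n\<close> and that of dx is \<open>(m - 1) n - m - 1\<close>; the orders
  of the factors of the differential add up to a nonnegative number.\<close>

lemma regular_degree_bound:
  assumes reg: "\<And>O'. is_place \<iota> O' \<Longrightarrow> regular_at sc d O' (sc (ev f * x ^ l) (d x))"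
    and f: "f \<noteq> 0" and l: "l < m"
  shows "m * (degree f + 1) + n * (l + 1) < n * m"
proof -
  define W where "W = (fls_X_inv ^ m :: 'a fls)"
  have ordW: "fls_subdegree W = - int m" by (simp add: W_def)
  have W: "W \<notin> range fls_const"
  proof
    assume "W \<in> range fls_const"
    then obtain c where "W = fls_const c" by auto
    hence "- int m = 0" using ordW by simp
    thus False using m by simp
  qed
  have ev_ord: "evL W P \<noteq> 0 \<and> fls_subdegree (evL W P) = int (degree P) * (- int m)" if "P \<noteq> 0" for P
    using evL_subdegree_pole[of W P] that ordW m by simp
  have "int m dvd fls_subdegree (evL W A)" using ev_ord[OF A] by simp
  from W this obtain \<Psi> X where \<Psi>: "field_hom \<Psi>" "\<And>a. \<Psi> (\<iota> a) = fls_const a" "\<Psi> w = W" "\<Psi> x = X"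
    and X: "X ^ m = evL W A" "X \<noteq> 0"
    and X': "of_nat m * X ^ (m - 1) * fls_deriv X = fls_const a0 * fls_deriv W"
    by (rule laurent_branch) blast
  let ?\<nu> = "fls_subdegree X"
  have "int m * ?\<nu> = fls_subdegree (evL W A)" by (simp add: fls_subdegree_pow flip: X(1))
  hence "int m * ?\<nu> = int m * (- int n)" using ev_ord[OF A] by (simp add: mult.commute)
  hence \<nu>: "?\<nu> = - int n" using m by (metis mult_left_cancel of_nat_0_eq_iff less_irrefl)
  have W': "fls_deriv W = of_nat m * - (fls_X_inv ^ Suc m)" by (simp add: W_def fls_deriv_X_inv_power)
  have X'1: "X ^ (m - 1) * fls_deriv X = - (fls_const a0 * fls_X_inv ^ Suc m)"
  proof -
    have "of_nat m * (X ^ (m - 1) * fls_deriv X) = of_nat m * - (fls_const a0 * fls_X_inv ^ Suc m)"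
      using X' unfolding W' by (simp add: mult_ac)
    thus ?thesis using m_nz_fls by (metis mult_left_cancel)
  qed
  moreover have "fls_const a0 * fls_X_inv ^ Suc m \<noteq> (0 :: 'a fls)" using A' by simp
  ultimately have X'nz: "fls_deriv X \<noteq> 0" by auto
  have "fls_subdegree (X ^ (m - 1) * fls_deriv X) = fls_subdegree (fls_const a0 * fls_X_inv ^ Suc m :: 'a fls)"
    by (simp only: X'1 fls_uminus_subdegree)
  also have "\<dots> = - int (Suc m)"
    using A'(2) by (subst fls_subdegree_mult) (simp_all del: power_Suc of_nat_Suc)
  finally have ord_X': "int (m - 1) * ?\<nu> + fls_subdegree (fls_deriv X) = - int (Suc m)"
    using X(2) X'nz by (simp add: fls_subdegree_pow)
  have "is_place \<iota> {h. fls_subdegree (\<Psi> h) \<ge> 0}"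
    by (rule laurent_place[OF \<Psi>(1,2), where y = w]) (simp add: \<Psi> ordW m)
  from regular_laurent[OF \<Psi>(1,2) reg[OF this]]
  have "0 \<le> fls_subdegree (evL W f * X ^ l * fls_deriv X)"
    by (simp add: \<Psi> field_homD[OF \<Psi>(1)] \<Psi>_ev[OF \<Psi>(1,2)])
  also have "\<dots> = int (degree f) * (- int m) + int l * ?\<nu> + fls_subdegree (fls_deriv X)"
    using X'nz X(2) ev_ord[OF f] by (simp add: fls_subdegree_pow)
  also have "fls_subdegree (fls_deriv X) = - int (Suc m) - int (m - 1) * ?\<nu>" using ord_X' by simp
  finally have "int m * (int (degree f) + 1) + int n * (int l + 1) + 1 \<le> int n * int m"
    using m(1) unfolding \<nu> by (simp add: algebra_simps of_nat_diff)
  hence "int (m * (degree f + 1) + n * (l + 1)) < int (n * m)" by (simp add: algebra_simps)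
  thus ?thesis by (simp only: of_nat_less_iff)
qed

text \<open>If dx vanished, every multiple of it would be regular, against the degree bound.\<close>

lemma dx_nonzero: "d x \<noteq> 0"
proof
  assume "d x = 0"
  hence "regular_at sc d O' (sc (ev (monom 1 n) * x ^ 0) (d x))" for O'
    unfolding regular_at_def by (intro exI[of _ "[]"]) simp
  \<comment> \<open>Already \<open>w^n dx\<close> violates the bound.\<close>
  from regular_degree_bound[OF this] m show False
    by (simp add: degree_monom_eq algebra_simps)
qed

end

section \<open>Valuation rings\<close>

text \<open>Regularity has to be shown at an arbitrary valuation ring, about which nothing explicit is known; the
  arithmetic of its maximal ideal suffices.\<close>

locale place =
  fixes \<iota> :: "'k::field \<Rightarrow> 'f::field" and R :: "'f set"
  assumes hom: "field_hom \<iota>" and place: "is_place \<iota> R"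
begin

lemma const_mem [simp]: "\<iota> c \<in> R"
  using place by (auto simp: is_place_def)

lemma diff_mem: "a \<in> R \<Longrightarrow> b \<in> R \<Longrightarrow> a - b \<in> R"
  and mult_mem: "a \<in> R \<Longrightarrow> b \<in> R \<Longrightarrow> a * b \<in> R"
  and mem_or_inverse_mem: "a \<in> R \<or> inverse a \<in> R"
  using place by (auto simp: is_place_def)

lemma zero_mem [simp]: "0 \<in> R" and one_mem [simp]: "1 \<in> R"
  using const_mem[of 0] const_mem[of 1] by (simp_all add: field_homD[OF hom])

lemma uminus_mem: "a \<in> R \<Longrightarrow> - a \<in> R"
  using diff_mem[of 0 a] by simp

lemma add_mem: "a \<in> R \<Longrightarrow> b \<in> R \<Longrightarrow> a + b \<in> R"
  using diff_mem[of a "- b"] uminus_mem[of b] by simp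

lemma power_mem: "a \<in> R \<Longrightarrow> a ^ n \<in> R"
  by (induction n) (auto intro: mult_mem)

lemma sum_mem: "(\<And>i. i \<in> S \<Longrightarrow> f i \<in> R) \<Longrightarrow> sum f S \<in> R"
  by (induction S rule: infinite_finite_induct) (auto intro: add_mem)

lemma evp_mem: "y \<in> R \<Longrightarrow> evp \<iota> y P \<in> R"
  by (induction P) (simp_all add: evp_pCons[of \<iota>] hom add_mem mult_mem)

definition nonunit :: "'f \<Rightarrow> bool" where
  "nonunit a \<longleftrightarrow> a \<in> R \<and> (a = 0 \<or> inverse a \<notin> R)"

lemma nonunit_inverse: "a \<notin> R \<Longrightarrow> nonunit (inverse a)"
  using mem_or_inverse_mem[of a] by (auto simp: nonunit_def)

lemma nonunit_mult: "nonunit a \<Longrightarrow> b \<in> R \<Longrightarrow> nonunit (a * b)"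
proof -
  assume a: "nonunit a" and b: "b \<in> R"
  have "inverse (a * b) \<notin> R" if "a * b \<noteq> 0"
  proof
    assume "inverse (a * b) \<in> R"
    hence "b * inverse (a * b) \<in> R" by (rule mult_mem[OF b])
    moreover have "b * inverse (a * b) = inverse a" using that by simp
    ultimately have "inverse a \<in> R" by argo
    thus False using a that by (simp add: nonunit_def)
  qed
  thus ?thesis using a b by (auto simp: nonunit_def mult_mem)
qed

text \<open>Of two elements one divides the other, say b divides a; then b divides the difference, so that a unit difference would make b a unit.\<close>

lemma nonunit_diff:
  assumes "nonunit a" "nonunit b"
  shows "nonunit (a - b)"
proof (cases "a = 0 \<or> b = 0")
  case True
  thus ?thesis using assms nonunit_mult[of b "-1"] uminus_mem[of 1] by auto
next
  case False
  have "inverse (a - b) \<notin> R" if ne: "a - b \<noteq> 0"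
  proof
    assume inv: "inverse (a - b) \<in> R"
    show False
    proof (cases "a / b \<in> R")
      case True
      hence "(a / b - 1) * inverse (a - b) \<in> R" using inv by (intro mult_mem diff_mem) auto
      also have "(a / b - 1) * inverse (a - b) = inverse b" using False ne by (simp add: field_simps)
      finally show False using assms False by (simp add: nonunit_def)
    next
      case nmem: False
      hence "b / a \<in> R" using mem_or_inverse_mem[of "a / b"] by simp
      hence "(1 - b / a) * inverse (a - b) \<in> R" using inv by (intro mult_mem diff_mem) auto
      also have "(1 - b / a) * inverse (a - b) = inverse a" using False ne by (simp add: field_simps)
      finally show False using assms False by (simp add: nonunit_def)
    qed
  qed
  thus ?thesis using assms by (auto simp: nonunit_def diff_mem)
qed

lemma unit_perturb:
  assumes "c \<noteq> 0" "nonunit a"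
  shows "\<iota> c + a \<noteq> 0" "\<iota> c + a \<in> R" "inverse (\<iota> c + a) \<in> R"
proof -
  have "\<not> nonunit (\<iota> c)"
    using assms(1) const_mem[of "inverse c"]
    by (simp add: nonunit_def field_hom_eq_0_iff[OF hom] field_hom_inverse[OF hom])
  hence "\<not> nonunit (\<iota> c + a)" using nonunit_diff[of "\<iota> c + a" a] assms(2) by auto
  moreover show "\<iota> c + a \<in> R" using assms(2) by (simp add: add_mem nonunit_def)
  ultimately show "\<iota> c + a \<noteq> 0" "inverse (\<iota> c + a) \<in> R" by (auto simp: nonunit_def)
qed

lemma integrally_closed:
  assumes "y ^ k \<in> R" "k > 0"
  shows "y \<in> R"
proof (rule ccontr)
  assume y: "y \<notin> R"
  hence "inverse y \<in> R" "y \<noteq> 0" using mem_or_inverse_mem[of y] by auto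
  hence "y ^ k * inverse y ^ (k - 1) \<in> R" by (intro mult_mem[OF assms(1)] power_mem)
  also have "y ^ k * inverse y ^ (k - 1) = y"
    using assms(2) \<open>y \<noteq> 0\<close> by (cases k) (simp_all add: field_simps)
  finally show False using y by simp
qed

text \<open>At a pole of y the right-hand side is a unit, so that a polynomial in y has the same order as its leading term.\<close>

lemma evp_leading_term:
  assumes "inverse y \<in> R" "y \<noteq> 0" "P \<noteq> 0"
  shows "\<exists>V\<in>R. evp \<iota> y P * inverse y ^ degree P = \<iota> (lead_coeff P) + inverse y * V"
  using assms(3)
proof (induction P)
  case (pCons a P)
  show ?case
  proof (cases "P = 0")
    case True thus ?thesis by (intro bexI[of _ 0]) (simp_all add: hom)
  next
    case False
    then obtain V where V: "V \<in> R" "evp \<iota> y P * inverse y ^ degree P = \<iota> (lead_coeff P) + inverse y * V"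
      using pCons by auto
    have "evp \<iota> y (pCons a P) * inverse y ^ degree (pCons a P)
        = inverse y * (\<iota> a * inverse y ^ degree P) + evp \<iota> y P * inverse y ^ degree P"
      using False assms(2) by (simp add: evp_pCons[of \<iota>] hom algebra_simps)
    also have "\<dots> = \<iota> (lead_coeff (pCons a P)) + inverse y * (V + \<iota> a * inverse y ^ degree P)"
      using False by (simp add: V(2) algebra_simps)
    finally have eq: "evp \<iota> y (pCons a P) * inverse y ^ degree (pCons a P) = \<dots>" .
    show ?thesis
      by (intro bexI[of _ "V + \<iota> a * inverse y ^ degree P"], rule eq)
        (intro add_mem mult_mem power_mem const_mem V(1) assms(1))
  qed
qed simp

end

section \<open>Construction of regular differentials\<close>

locale curve_place = separable_superelliptic \<iota> w x A m \<zeta> \<mu> sc d a0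
  for \<iota> :: "'k::alg_closed_field \<Rightarrow> 'f::field" and w x A m \<zeta> \<mu> and sc :: "'f \<Rightarrow> 'w::ab_group_add \<Rightarrow> 'w" and d a0 +
  fixes R :: "'f set"
  assumes is_place_R: "is_place \<iota> R"
begin

sublocale R: place \<iota> R
  by unfold_locales (use \<iota> is_place_R in auto)

text \<open>The quotient \<open>x^m / w^n\<close> compares the poles of x and w: it is a unit wherever w has a pole.\<close>

definition U :: 'f where "U = x ^ m * inverse w ^ n"

lemma w_nz: "w \<noteq> 0"
  using w by (metis \<iota> field_homD(1) rangeI)

lemma U_unit:
  assumes "w \<notin> R"
  shows "U \<noteq> 0" "U \<in> R" "inverse U \<in> R" "\<not> R.nonunit U"
proof -
  have "R.nonunit (inverse w)" using assms by (rule R.nonunit_inverse)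
  moreover from this have iw: "inverse w \<in> R" by (simp add: R.nonunit_def)
  then obtain V where V: "V \<in> R" "U = \<iota> (lead_coeff A) + inverse w * V"
    using R.evp_leading_term[of w A] w_nz A unfolding U_def eqn by blast
  ultimately have "R.nonunit (inverse w * V)" by (intro R.nonunit_mult)
  with R.unit_perturb[of "lead_coeff A"] A V
  show "U \<noteq> 0" "U \<in> R" "inverse U \<in> R" by auto
  thus "\<not> R.nonunit U" by (simp add: R.nonunit_def)
qed

lemma w_mem_iff: "w \<in> R \<longleftrightarrow> x \<in> R"
proof
  assume "w \<in> R"
  hence "x ^ m \<in> R" unfolding eqn by (rule R.evp_mem)
  thus "x \<in> R" using m(1) by (rule R.integrally_closed)
next
  assume x: "x \<in> R"
  show "w \<in> R"
  proof (rule ccontr)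
    assume w': "w \<notin> R"
    hence iw: "R.nonunit (inverse w)" by (rule R.nonunit_inverse)
    have "inverse w ^ n = inverse w * inverse w ^ (n - 1)" using degA by (cases n) auto
    hence "R.nonunit (inverse w * (inverse w ^ (n - 1) * x ^ m))"
      using iw x by (intro R.nonunit_mult R.mult_mem R.power_mem) (auto simp: R.nonunit_def)
    also have "inverse w * (inverse w ^ (n - 1) * x ^ m) = U"
      using \<open>inverse w ^ n = _\<close> by (simp add: U_def)
    finally show False using U_unit[OF w'] by simp
  qed
qed

lemma power_int_mem:
  "a \<in> R \<Longrightarrow> k \<ge> 0 \<Longrightarrow> a powi k \<in> R" "inverse a \<in> R \<Longrightarrow> k \<le> 0 \<Longrightarrow> a powi k \<in> R"
  by (auto simp: power_int_def R.power_mem)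

text \<open>The n-th power of the monomial is a power of x with nonpositive exponent times a power of the unit
  U, so it lies in the ring; a valuation ring is integrally closed.\<close>

lemma monomial_mem:
  assumes x': "x \<notin> R" and ab: "int n * a + int m * b \<le> 0"
  shows "x powi a * w powi b \<in> R"
proof -
  have w': "w \<notin> R" using x' w_mem_iff by simp
  have ix: "inverse x \<in> R" using x' R.mem_or_inverse_mem by blast
  have wn: "w ^ n = x ^ m * inverse U" unfolding U_def using w_nz x_nz by (simp add: field_simps)
  have "(w powi b) ^ n = (w ^ n) powi b"
    by (metis power_int_mult power_int_of_nat mult.commute)
  also have "\<dots> = x powi (int m * b) * U powi (- b)"
    unfolding wn power_int_mult_distrib
    by (metis power_int_inverse power_int_minus power_int_mult power_int_of_nat)
  finally have 1: "(w powi b) ^ n = x powi (int m * b) * U powi (- b)" .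
  have "(x powi a * w powi b) ^ n = x powi (a * int n) * (x powi (int m * b) * U powi (- b))"
    unfolding power_mult_distrib 1 by (metis power_int_mult power_int_of_nat)
  also have "\<dots> = x powi (int n * a + int m * b) * U powi (- b)"
    using x_nz by (simp add: power_int_add mult.commute)
  finally have 2: "(x powi a * w powi b) ^ n = \<dots>" .
  have "x powi (int n * a + int m * b) \<in> R" using ix ab by (intro power_int_mem(2))
  moreover have "U powi (- b) \<in> R"
    using power_int_mem[of U "- b"] U_unit[OF w'] by (cases "b \<le> 0") auto
  ultimately have "(x powi a * w powi b) ^ n \<in> R" unfolding 2 by (rule R.mult_mem)
  thus ?thesis using degA by (auto intro: R.integrally_closed[of _ n])
qed

text \<open>Where x is finite, so is w, and the differential is visibly of the form \<open>f dg\<close>. At a pole of x, choose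
  r and s with \<open>n r + m s = -1\<close>; then \<open>t = x^r w^s\<close> has order 1 and dt is \<open>t x^(m-1) w^(-1) E dx\<close> with a unit E.
  Writing the differential as \<open>h dt\<close>, all monomials of h have nonnegative order.\<close>

lemma regular_monomials:
  assumes f: "\<And>i. coeff f i \<noteq> 0 \<Longrightarrow> m * (i + 1) + n * c < n * m" and c: "1 \<le> c" "c < m"
  shows "regular_at sc d R (sc (ev f * x ^ (c - 1)) (d x))"
proof (cases "x \<in> R")
  case True
  thus ?thesis using w_mem_iff by (intro regular_atI R.mult_mem R.evp_mem R.power_mem) auto
next
  case x': False
  hence w': "w \<notin> R" using w_mem_iff by simp
  from degA(2) have "gcd (int n) (int m) = 1" by simp
  then obtain r' s' where "r' * int n + s' * int m = 1" using bezout_int by metis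
  then obtain r s where rs: "int n * r + int m * s = -1"
    using that[of "- r'" "- s'"] by (metis add.inverse_distrib_swap add.commute mult.commute mult_minus_right)
  define t where "t = x powi r * w powi s"
  have t_nz: "t \<noteq> 0" using x_nz w_nz by (simp add: t_def)
  have t: "t \<in> R" unfolding t_def using x' rs by (intro monomial_mem) simp_all
  define E where "E = \<iota> (of_int s * of_nat m / a0) + of_int r * (w * x powi (- int m))"
  have dw': "d w = sc (\<iota> (of_nat m / a0) * x ^ (m - 1)) (d x)"
  proof -
    have "sc (\<iota> (inverse a0)) (sc (\<iota> a0) (d w)) = sc (\<iota> (inverse a0) * (of_nat m * x ^ (m - 1))) (d x)"
      by (simp add: dw)
    moreover have "\<iota> (inverse a0) * \<iota> a0 = 1"
      using A'(2) by (simp add: field_homD(2)[OF \<iota>] flip: field_homD(4)[OF \<iota>])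
    moreover have "\<iota> (inverse a0) * of_nat m = \<iota> (of_nat m / a0)"
      by (simp add: divide_inverse field_homD[OF \<iota>] mult.commute)
    ultimately show ?thesis by (simp flip: mult.assoc)
  qed
  have dt: "d t = sc (t * x powi (int m - 1) * inverse w * E) (d x)"
  proof -
    have "d t = sc (x powi r) (sc (of_int s * w powi (s - 1)) (d w))
        + sc (w powi s) (sc (of_int r * x powi (r - 1)) (d x))"
      unfolding t_def d_mult d_power_int[OF x_nz] d_power_int[OF w_nz] ..
    also have "\<dots> = sc (x powi r * (of_int s * w powi (s - 1)) * (\<iota> (of_nat m / a0) * x ^ (m - 1))
        + w powi s * (of_int r * x powi (r - 1))) (d x)"
      by (simp add: dw' scale_left_distrib)
    also have "x powi r * (of_int s * w powi (s - 1)) * (\<iota> (of_nat m / a0) * x ^ (m - 1))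
        + w powi s * (of_int r * x powi (r - 1)) = t * x powi (int m - 1) * inverse w * E"
    proof -
      have "x ^ (m - 1) = x powi (int m - 1)"
        using m(1) by (simp add: of_nat_diff flip: power_int_of_nat)
      moreover have "w powi (s - 1) = w powi s * inverse w"
        using w_nz by (simp add: power_int_diff divide_inverse)
      moreover have "x powi (r - 1) = x powi r * (x powi (int m - 1) * x powi (- int m))"
        using x_nz by (simp add: power_int_diff power_int_minus field_simps)
      moreover have "\<iota> (of_int s * of_nat m / a0) = of_int s * \<iota> (of_nat m / a0)"
        using field_homD(4)[OF \<iota>, of "of_int s" "of_nat m / a0"]
        by (simp add: field_hom_of_int[OF \<iota>])
      ultimately show ?thesis unfolding t_def E_def using w_nz by (simp add: field_simps)
    qed
    finally show ?thesis .
  qed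
  have E: "E \<noteq> 0" "inverse E \<in> R"
  proof -
    have "coeff (pderiv A) (n - 1) = 0" using degA by (simp add: A' coeff_pCons split: nat.splits)
    \<comment> \<open>The top coefficient of A' is n times that of A, so the characteristic divides n and s is invertible in k.\<close>
    hence n0: "of_nat n = (0 :: 'k)" using degA A by (simp add: coeff_pderiv)
    have "of_int (int n * r + int m * s) = (- 1 :: 'k)" by (simp add: rs)
    hence "of_nat m * of_int s = (- 1 :: 'k)" using n0 by simp
    hence s: "of_int s * of_nat m / a0 \<noteq> 0" using A'(2) by (metis divide_eq_0_iff mult.commute neg_equal_0_iff_equal zero_neq_one)
    have "int n * (1 - int m) + int m \<le> 0"
    proof -
      have "2 * (int m - 1) \<le> int n * (int m - 1)" using degA m(1) by (intro mult_right_mono) auto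
      thus ?thesis using c by (simp add: algebra_simps)
    qed
    hence "x powi (1 - int m) * w powi 1 \<in> R" using x' by (intro monomial_mem) simp_all
    moreover have "of_int r \<in> R" by (metis R.const_mem field_hom_of_int[OF \<iota>])
    ultimately have "of_int r * (x powi (1 - int m) * w) \<in> R" by (simp add: R.mult_mem)
    hence "R.nonunit (inverse x * (of_int r * (x powi (1 - int m) * w)))"
      by (rule R.nonunit_mult[OF R.nonunit_inverse[OF x']])
    also have "inverse x * (of_int r * (x powi (1 - int m) * w)) = of_int r * (w * x powi (- int m))"
      using x_nz by (simp add: power_int_diff power_int_minus field_simps)
    finally show "E \<noteq> 0" "inverse E \<in> R" unfolding E_def using R.unit_perturb[OF s] by blast+
  qed
  let ?h = "(\<Sum>i<Suc (degree f). \<iota> (coeff f i) * (x powi (int c - int m - r) * w powi (int i + 1 - s))) * inverse E"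
  have h: "?h \<in> R"
  proof (rule R.mult_mem[OF R.sum_mem E(2)])
    fix i
    show "\<iota> (coeff f i) * (x powi (int c - int m - r) * w powi (int i + 1 - s)) \<in> R"
    proof (cases "coeff f i = 0")
      case True thus ?thesis by (simp add: field_homD[OF \<iota>])
    next
      case False
      have "int (m * (i + 1) + n * c) < int (n * m)" using f[OF False] by (simp only: of_nat_less_iff)
      hence "int n * (int c - int m - r) + int m * (int i + 1 - s) \<le> 0"
        using rs by (simp add: algebra_simps)
      thus ?thesis using x' by (intro R.mult_mem[OF R.const_mem] monomial_mem)
    qed
  qed
  have "ev f * x ^ (c - 1) = ?h * (t * x powi (int m - 1) * inverse w * E)"
  proof -
    have "x ^ (c - 1) = x powi (int c - 1)"
      using c by (simp add: of_nat_diff flip: power_int_of_nat)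
    hence 1: "w ^ i * x ^ (c - 1) = x powi (int c - int m - r) * w powi (int i + 1 - s) * (t * x powi (int m - 1) * inverse w)" for i
      unfolding t_def using x_nz w_nz by (simp add: power_int_diff power_int_add field_simps)
    have "ev f * x ^ (c - 1) = (\<Sum>i<Suc (degree f). \<iota> (coeff f i) * (w ^ i * x ^ (c - 1)))"
      using \<iota> by (subst evp_altdef[of \<iota> f "Suc (degree f)"]) (simp_all add: sum_distrib_right mult.assoc del: sum.lessThan_Suc)
    also have "\<dots> = (\<Sum>i<Suc (degree f). \<iota> (coeff f i) * (x powi (int c - int m - r) * w powi (int i + 1 - s))) * (t * x powi (int m - 1) * inverse w)"
      unfolding 1 sum_distrib_right by (simp only: mult.assoc)
    finally show ?thesis using E(1) by simp
  qed
  hence "sc (ev f * x ^ (c - 1)) (d x) = sc ?h (d t)" unfolding dt by simp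
  thus ?thesis using regular_atI[OF h t] by argo
qed

end

section \<open>Polynomials and the translation lattice\<close>

abbreviation polys_below :: "nat \<Rightarrow> 'k::field poly set" where
  "polys_below n \<equiv> {f. \<forall>i\<ge>n. coeff f i = 0}"

abbreviation translate :: "'k::field \<Rightarrow> 'k poly \<Rightarrow> 'k poly" where
  "translate a f \<equiv> pcompose f [:a, 1:]"

lemma polys_below_iff: "f \<in> polys_below n \<longleftrightarrow> f = 0 \<or> degree f < n"
  using le_degree[of f] by (auto simp: not_less intro: coeff_eq_0)

lemma degree_translate: "degree (translate a f) = degree f"
  by (simp add: degree_pcompose)

lemma translate_mem: "f \<in> polys_below n \<Longrightarrow> translate a f \<in> polys_below n"
  unfolding polys_below_iff by (auto simp: degree_translate)

text \<open>Translation fixes the leading coefficient.\<close>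

lemma degree_translate_diff:
  assumes "translate a f - f \<noteq> 0"
  shows "degree (translate a f - f) < degree f"
proof -
  have "coeff (translate a f - f) (degree f) = 0"
    using lead_coeff_comp[of "[:a, 1:]" f] by (simp add: degree_translate)
  moreover have "degree (translate a f - f) \<le> degree f"
    by (rule degree_diff_le) (simp_all add: degree_translate)
  ultimately show ?thesis using assms by (metis le_neq_implies_less leading_coeff_0_iff)
qed

lemma smult_sum_right: "smult c (\<Sum>i\<in>S. f i) = (\<Sum>i\<in>S. smult c (f i))"
  by (induction S rule: infinite_finite_induct) (simp_all add: smult_add_right)

text \<open>By induction over the coefficients of f: multiplication by \<open>w + a\<close> raises the degrees in w and in a by at most one.\<close>

lemma taylor_expansion:
  assumes "f \<in> polys_below n"
  shows "\<exists>c. (\<forall>l. c l \<in> polys_below n) \<and> (\<forall>a. translate a f = (\<Sum>l<n. smult (a ^ l) (c l)))"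
  using assms
proof (induction n arbitrary: f)
  case 0
  hence "f = 0" by (auto intro: poly_eqI)
  thus ?case by (intro exI[of _ "\<lambda>_. 0"]) simp
next
  case (Suc n)
  obtain b g where f: "f = pCons b g" by (cases f)
  have "g \<in> polys_below n" using Suc.prems by (force simp: f coeff_pCons split: nat.splits)
  then obtain c where c: "\<And>l. c l \<in> polys_below n" "\<And>a. translate a g = (\<Sum>l<n. smult (a ^ l) (c l))"
    using Suc.IH by blast
  define c' where "c' = (\<lambda>l. (if l = 0 then [:b:] else c (l - 1)) + (if l < n then pCons 0 (c l) else 0))"
  have "c' l \<in> polys_below (Suc n)" for l
    using c(1)[of l] c(1)[of "l - 1"] by (auto simp: c'_def coeff_pCons split: nat.splits)
  moreover have "translate a f = (\<Sum>l<Suc n. smult (a ^ l) (c' l))" for a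
  proof -
    have "(\<Sum>l<Suc n. smult (a ^ l) (c' l)) =
        (\<Sum>l<Suc n. smult (a ^ l) (if l = 0 then [:b:] else c (l - 1)))
        + (\<Sum>l<Suc n. smult (a ^ l) (if l < n then pCons 0 (c l) else 0))"
      by (simp add: c'_def smult_add_right sum.distrib)
    also have "(\<Sum>l<Suc n. smult (a ^ l) (if l = 0 then [:b:] else c (l - 1)))
        = [:b:] + smult a (translate a g)"
      by (subst sum.lessThan_Suc_shift) (simp add: c(2) smult_sum_right)
    also have "(\<Sum>l<Suc n. smult (a ^ l) (if l < n then pCons 0 (c l) else 0)) = [:0, 1:] * translate a g"
      by (simp add: c(2) sum_distrib_left mult_smult_right flip: smult_sum_right)
    finally show ?thesis by (simp add: f pcompose_pCons)
  qed
  ultimately show ?case by blast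
qed

lemma poly_eq_0_by_roots:
  fixes f :: "'k::field poly"
  assumes "finite S" "\<And>a. a \<in> S \<Longrightarrow> poly f a = 0" "f \<in> polys_below (card S)"
  shows "f = 0"
proof (rule ccontr)
  assume f: "f \<noteq> 0"
  have "card S \<le> card {a. poly f a = 0}"
    using assms poly_roots_finite[OF f] by (intro card_mono) auto
  also have "\<dots> \<le> degree f" using f by (rule card_poly_roots_bound)
  finally show False using f assms(3) by (auto simp: polys_below_iff simp del: mem_Collect_eq)
qed

text \<open>Lagrange interpolation at the points of S expresses f through its values. All denominators
  \<open>\<Prod>b\<noteq>a. (a - b)\<close> are equal, since S is a group, so the top coefficient of f is a constant times the sum
  of its values. In particular the sum vanishes for polynomials of smaller degree.\<close>

lemma sum_over_subgroup:
  fixes S :: "'k::field set"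
  assumes S: "finite S" "0 \<in> S" "\<And>a b. a \<in> S \<Longrightarrow> b \<in> S \<Longrightarrow> a - b \<in> S"
  obtains C where "C \<noteq> 0" "\<And>f. f \<in> polys_below (card S) \<Longrightarrow> (\<Sum>a\<in>S. poly f a) = C * coeff f (card S - 1)"
proof -
  define C where "C = (\<Prod>b\<in>S - {0}. b)"
  have C: "C \<noteq> 0" using S by (simp add: C_def)
  have prodC: "(\<Prod>b\<in>S - {a}. a - b) = C" if a: "a \<in> S" for a
    unfolding C_def
    by (rule prod.reindex_bij_witness[of _ "\<lambda>b. a - b" "\<lambda>b. a - b"]) (use a S in auto)
  have "(\<Sum>a\<in>S. poly f a) = C * coeff f (card S - 1)" if f: "f \<in> polys_below (card S)" for f
  proof -
    define q where "q = (\<lambda>a. \<Prod>b\<in>S - {a}. [:-b, 1:])"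
    have q: "degree (q a) = card S - 1" "lead_coeff (q a) = 1" if "a \<in> S" for a
      unfolding q_def using that S
      by (subst degree_prod_eq_sum_degree) (auto simp: lead_coeff_prod)
    define P where "P = (\<Sum>a\<in>S. smult (poly f a) (q a))"
    have "poly P a = C * poly f a" if a: "a \<in> S" for a
    proof -
      have "poly P a = (\<Sum>a'\<in>S. if a' = a then C * poly f a else 0)"
        unfolding P_def poly_sum
      proof (intro sum.cong refl)
        fix a' assume a': "a' \<in> S"
        show "poly (smult (poly f a') (q a')) a = (if a' = a then C * poly f a else 0)"
        proof (cases "a' = a")
          case True thus ?thesis using prodC[OF a] by (simp add: q_def poly_prod)
        next
          case False
          hence "poly (q a') a = 0" using a S by (auto simp: q_def poly_prod)
          thus ?thesis using False by simp
        qed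
      qed
      thus ?thesis using a S by simp
    qed
    moreover have "P \<in> polys_below (card S)"
    proof -
      have "card S > 0" using S card_gt_0_iff by blast
      hence "coeff (q a) i = 0" if "a \<in> S" "i \<ge> card S" for a i
        using q(1)[OF that(1)] that(2) by (intro coeff_eq_0) linarith
      thus ?thesis by (auto simp: P_def coeff_sum)
    qed
    ultimately have "smult C f - P = 0"
      using f S(1) by (intro poly_eq_0_by_roots[of S]) auto
    hence "C * coeff f (card S - 1) = coeff P (card S - 1)" by (metis coeff_smult right_minus_eq)
    also have "\<dots> = (\<Sum>a\<in>S. poly f a)"
      using q unfolding P_def coeff_sum by (intro sum.cong) auto
    finally show ?thesis ..
  qed
  thus ?thesis using that C by blast
qed

lemma frob_diff:
  fixes a b :: "'k::field"
  assumes p: "p = CHAR('k)" "prime p"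
  shows "(a - b) ^ p = a ^ p - b ^ p"
  using freshmans_dream[of p "a - b" b] p by (simp add: algebra_simps)

lemma frob_of_nat:
  assumes p: "p = CHAR('k::field)" "prime p"
  shows "(of_nat i :: 'k) ^ p = of_nat i"
proof (induction i)
  case 0 thus ?case using p prime_gt_0_nat by (simp add: power_0_left)
next
  case (Suc i)
  thus ?case using freshmans_dream[of p 1 "of_nat i :: 'k"] p by simp
qed

lemma of_nat_eq_below_char:
  assumes p: "p = CHAR('k::field)"
  shows "i < p \<Longrightarrow> j < p \<Longrightarrow> (of_nat i :: 'k) = of_nat j \<longleftrightarrow> i = j"
proof (induction i j rule: linorder_wlog)
  case (le i j)
  have "(of_nat (j - i) :: 'k) = 0 \<longleftrightarrow> p dvd j - i"
    unfolding p by (rule of_nat_eq_0_iff_char_dvd)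
  moreover have "p dvd j - i \<longleftrightarrow> j - i = 0" using le by (auto dest: dvd_imp_le)
  ultimately show ?case using le by (auto simp: of_nat_diff)
qed auto

text \<open>The polynomial \<open>X^p - X\<close> already has p roots in the prime field.\<close>

lemma frob_fixed:
  fixes y :: "'k::field"
  assumes p: "p = CHAR('k)" "prime p" and y: "y ^ p = y"
  shows "y \<in> range of_int"
proof (rule ccontr)
  assume "y \<notin> range of_int"
  hence y': "y \<notin> of_nat ` {..<p}" by (metis imageE of_int_of_nat_eq rangeI)
  let ?S = "insert y (of_nat ` {..<p}) :: 'k set"
  have "card (of_nat ` {..<p} :: 'k set) = p"
    using of_nat_eq_below_char[OF p(1)] by (subst card_image) (auto simp: inj_on_def)
  hence card: "card ?S = Suc p" using y' by simp
  have p2: "p \<ge> 2" using p(2) by (rule prime_ge_2_nat)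
  have "monom 1 p - monom 1 1 = (0 :: 'k poly)"
  proof (rule poly_eq_0_by_roots[of ?S])
    show "monom 1 p - monom 1 1 \<in> polys_below (card ?S)" using p2 unfolding card by auto
  qed (auto simp: poly_monom y frob_of_nat[OF p])
  from arg_cong[OF this, of "\<lambda>q. coeff q p"] show False using p2 by simp
qed

text \<open>The condition on \<open>\<beta>\<close> says that it lies outside the prime field, so that 1 and \<open>\<beta>\<close> span a group of order \<open>p^2\<close>.\<close>

locale translation_lattice =
  fixes p :: nat and \<beta> :: "'k::field"
  assumes p: "p = CHAR('k)" "prime p" and \<beta>: "\<beta> ^ p \<noteq> \<beta>"
begin

definition pt :: "nat \<times> nat \<Rightarrow> 'k" where
  "pt = (\<lambda>(i, j). of_nat j - of_nat i * \<beta>)"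

lemmas frob_lattice = frob_diff[OF p] frob_of_nat[OF p]
lemmas of_nat_eq = of_nat_eq_below_char[OF p(1)]

lemma pt_frob: "pt (i, j) ^ p = of_nat j - of_nat i * \<beta> ^ p"
  by (simp add: pt_def frob_lattice power_mult_distrib)

lemma of_nat_mod: "(of_nat (i mod p) :: 'k) = of_nat i"
proof -
  have "(of_nat i :: 'k) = of_nat (p * (i div p) + i mod p)" by simp
  also have "\<dots> = of_nat (i mod p)" unfolding of_nat_add of_nat_mult by (simp add: p(1))
  finally show ?thesis ..
qed

lemma pt_inj: "inj_on pt (H_group p)"
proof (rule inj_onI)
  fix u v assume uv: "u \<in> H_group p" "v \<in> H_group p" "pt u = pt v"
  obtain i j i' j' where [simp]: "u = (i, j)" "v = (i', j')" by (cases u, cases v)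
  have lt: "i < p" "j < p" "i' < p" "j' < p" using uv by (auto simp: H_group_def)
  have eq: "(of_nat j - of_nat j' :: 'k) = (of_nat i - of_nat i') * \<beta>"
    using uv(3) by (simp add: pt_def algebra_simps)
  have "i = i'"
  proof (rule ccontr)
    assume "i \<noteq> i'"
    hence "(of_nat i - of_nat i' :: 'k) \<noteq> 0" using of_nat_eq lt by simp
    hence "\<beta> = (of_nat j - of_nat j') / (of_nat i - of_nat i')" using eq by (simp add: field_simps)
    hence "\<beta> ^ p = \<beta>" by (simp add: power_divide frob_lattice)
    thus False using \<beta> by simp
  qed
  thus "u = v" using eq of_nat_eq lt by simp
qed

lemma finite_H: "finite (H_group p)" and card_H: "card (H_group p) = p\<^sup>2"
  by (simp_all add: H_group_def power2_eq_square)

lemma card_pts: "card (pt ` H_group p) = p\<^sup>2"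
  using card_image[OF pt_inj] card_H by simp

lemma pts_periodic: "pt ` H_group p = range pt"
proof -
  have pos: "p > 0" using p(2) prime_gt_0_nat by blast
  have "pt (i, j) = pt (i mod p, j mod p)" for i j
    by (simp add: pt_def of_nat_mod)
  moreover have "(i mod p, j mod p) \<in> H_group p" for i j using pos by (simp add: H_group_def)
  ultimately show ?thesis by (auto simp: image_def) blast
qed

text \<open>The points form a group because the coordinates i and j only matter modulo p.\<close>

lemma pts_power_sum:
  obtains C where "C \<noteq> 0"
    "\<And>f. f \<in> polys_below (p\<^sup>2) \<Longrightarrow> (\<Sum>h\<in>H_group p. poly f (pt h)) = C * coeff f (p\<^sup>2 - 1)"
proof -
  have "pt (i, j) - pt (i', j') = pt (i + (p - 1) * i', j + (p - 1) * j')" for i j i' j'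
  proof -
    have "p \<ge> 1" using p(2) prime_ge_1_nat by blast
    hence "(of_nat (p - 1) :: 'k) = - 1" using p by (simp add: of_nat_diff)
    thus ?thesis by (simp only: pt_def prod.case of_nat_add of_nat_mult) (simp add: algebra_simps)
  qed
  hence "a - b \<in> range pt" if "a \<in> range pt" "b \<in> range pt" for a b using that by force
  hence diff: "a - b \<in> pt ` H_group p" if "a \<in> pt ` H_group p" "b \<in> pt ` H_group p" for a b
    using that by (simp only: pts_periodic)
  have zero: "0 \<in> pt ` H_group p"
    unfolding pts_periodic by (rule image_eqI[of _ _ "(0, 0)"]) (simp_all add: pt_def)
  have fin: "finite (pt ` H_group p)" using finite_H by simp
  show ?thesis
  proof (rule sum_over_subgroup[OF fin zero diff, unfolded card_pts])
    fix C :: 'k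
    assume C: "C \<noteq> 0"
      "\<And>f. f \<in> polys_below (p\<^sup>2) \<Longrightarrow> (\<Sum>a\<in>pt ` H_group p. poly f a) = C * coeff f (p\<^sup>2 - 1)"
    show ?thesis
      by (rule that[OF C(1)]) (simp only: C(2)[symmetric] sum.reindex[OF pt_inj] comp_def)
  qed
qed

lemma poly_eq_by_pts:
  assumes "f \<in> polys_below (p\<^sup>2)" "g \<in> polys_below (p\<^sup>2)" "\<And>h. h \<in> H_group p \<Longrightarrow> poly f (pt h) = poly g (pt h)"
  shows "f = g"
proof -
  have "f - g = 0"
    by (rule poly_eq_0_by_roots[of "pt ` H_group p"]) (use assms finite_H card_pts in auto)
  thus ?thesis by simp
qed

end

text \<open>Additive maps from the lattice to k are spanned by the inclusion and its p-th power. The coefficients are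
  determined by the values at 1 and \<open>-\<beta>1\<close>, and v vanishes only if the two parameters agree.\<close>

lemma lattice_change:
  assumes L1: "translation_lattice p \<beta>1" and L2: "translation_lattice p \<beta>2"
  defines "v \<equiv> (\<beta>2 - \<beta>1) / (\<beta>1 ^ p - \<beta>1)"
  shows "translation_lattice.pt \<beta>2 h
    = (1 - v) * translation_lattice.pt \<beta>1 h + v * translation_lattice.pt \<beta>1 h ^ p"
proof -
  interpret L1: translation_lattice p \<beta>1 by (rule L1)
  interpret L2: translation_lattice p \<beta>2 by (rule L2)
  obtain i j where h: "h = (i, j)" by (cases h)
  have "v * (\<beta>1 ^ p - \<beta>1) = \<beta>2 - \<beta>1" using L1.\<beta> by (simp add: v_def)
  hence eq: "\<beta>2 = (1 - v) * \<beta>1 + v * \<beta>1 ^ p" by (simp add: algebra_simps)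
  have "L2.pt h = of_nat j - of_nat i * ((1 - v) * \<beta>1 + v * \<beta>1 ^ p)"
    by (simp add: h L2.pt_def flip: eq)
  thus ?thesis unfolding h L1.pt_frob unfolding L1.pt_def by (simp add: algebra_simps)
qed

text \<open>Let y and \<open>y'\<close> be the coordinates for \<open>\<beta>1\<close> and \<open>\<beta>2\<close>, and suppose that \<open>\<beta>1 \<noteq> \<beta>2\<close>. If
  \<open>n \<le> p (p - 1)\<close>, a suitable power \<open>y'^k\<close> with \<open>k < n\<close> has degree \<open>p k \<ge> n\<close> in y; as this is below \<open>p^2\<close>,
  no polynomial of smaller degree gives the same function. If \<open>n > p (p - 1)\<close>, then \<open>p^2 - 1 - p < n\<close>,
  and \<open>y'^(p^2 - 1 - p)\<close> has degree less than n in y. Its sum against y is zero because \<open>n < p^2 - 1\<close>;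
  expressed in \<open>y'\<close>, the product has degree \<open>p^2 - 1\<close>, and its sum is nonzero.\<close>

lemma lattice_parameter_unique:
  assumes L1: "translation_lattice p \<beta>1" and L2: "translation_lattice p \<beta>2"
    and n: "2 \<le> n" "n \<le> p\<^sup>2 - 2"
    and Q: "\<And>g. g \<in> polys_below n \<Longrightarrow> \<exists>Q\<in>polys_below n. \<forall>h\<in>H_group p.
      poly g (translation_lattice.pt \<beta>2 h) = poly Q (translation_lattice.pt \<beta>1 h)"
  shows "\<beta>1 = \<beta>2"
proof (rule ccontr)
  assume ne: "\<beta>1 \<noteq> \<beta>2"
  interpret L1: translation_lattice p \<beta>1 by (rule L1)
  interpret L2: translation_lattice p \<beta>2 by (rule L2)
  have p2: "p \<ge> 2" using L1.p prime_ge_2_nat by blast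
  show False
  proof (cases "n \<le> p * (p - 1)")
    case True
    define v where "v = (\<beta>2 - \<beta>1) / (\<beta>1 ^ p - \<beta>1)"
    have v: "v \<noteq> 0" using ne L1.\<beta> by (simp add: v_def)
    \<comment> \<open>Chosen with \<open>k < n \<le> p k\<close> and \<open>p k < p^2\<close>.\<close>
    define k where "k = (if n \<le> p then 1 else p - 1)"
    have k: "k < n" "n \<le> p * k" "k \<le> p - 1" using True n p2 by (auto simp: k_def)
    define L where "L = monom v p + monom (1 - v) 1"
    have degL: "degree L = p" "lead_coeff L = v"
    proof -
      have "coeff L p = v" using p2 by (simp add: L_def)
      moreover have "degree L \<le> p"
        unfolding L_def using p2 by (intro degree_add_le) (auto intro: order_trans[OF degree_monom_le])
      ultimately show "degree L = p" using v le_degree[of L p] by force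
      thus "lead_coeff L = v" using \<open>coeff L p = v\<close> by simp
    qed
    have "monom 1 k \<in> polys_below n" using k(1) by auto
    from Q[OF this] obtain Q where Q': "Q \<in> polys_below n"
      "\<And>h. h \<in> H_group p \<Longrightarrow> poly (monom 1 k) (L2.pt h) = poly Q (L1.pt h)"
      by blast
    have "L \<noteq> 0" using degL(2) v by auto
    hence dk: "degree (L ^ k) = k * p" by (simp add: degree_power_eq degL(1))
    have "k * p < p\<^sup>2" using k(3) p2 by (simp add: power2_eq_square)
    have "L ^ k = Q"
    proof (rule L1.poly_eq_by_pts)
      show "L ^ k \<in> polys_below (p\<^sup>2)" using dk \<open>k * p < p\<^sup>2\<close> unfolding polys_below_iff by simp
      show "Q \<in> polys_below (p\<^sup>2)" using Q'(1) n by auto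
      fix h assume "h \<in> H_group p"
      from Q'(2)[OF this] show "poly (L ^ k) (L1.pt h) = poly Q (L1.pt h)"
        unfolding poly_monom lattice_change[OF L1 L2, of h, folded v_def]
        by (simp add: L_def poly_monom add.commute)
    qed
    moreover have "coeff (L ^ k) (k * p) \<noteq> 0"
      using v degL dk by (metis lead_coeff_power power_not_zero)
    ultimately show False using Q'(1) k(2) by (simp add: mult.commute)
  next
    case False
    define v where "v = (\<beta>1 - \<beta>2) / (\<beta>2 ^ p - \<beta>2)"
    have v: "v \<noteq> 0" using ne L2.\<beta> by (simp add: v_def)
    have pp: "p * (p - 1) = p\<^sup>2 - p" by (simp add: power2_eq_square diff_mult_distrib2)
    have "p\<^sup>2 \<ge> 2 * p" using p2 by (simp add: power2_eq_square)
    define e where "e = p\<^sup>2 - 1 - p"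
    have e: "e < n" using False pp \<open>p\<^sup>2 \<ge> 2 * p\<close> p2 unfolding e_def by linarith
    have "monom 1 e \<in> polys_below n" using e by auto
    from Q[OF this] obtain Q where Q': "Q \<in> polys_below n"
      "\<And>h. h \<in> H_group p \<Longrightarrow> poly (monom 1 e) (L2.pt h) = poly Q (L1.pt h)"
      by blast
    obtain C1 where C1: "\<And>f. f \<in> polys_below (p\<^sup>2) \<Longrightarrow> (\<Sum>h\<in>H_group p. poly f (L1.pt h)) = C1 * coeff f (p\<^sup>2 - 1)"
      using L1.pts_power_sum by blast
    obtain C2 where C2: "C2 \<noteq> 0" "\<And>f. f \<in> polys_below (p\<^sup>2) \<Longrightarrow> (\<Sum>h\<in>H_group p. poly f (L2.pt h)) = C2 * coeff f (p\<^sup>2 - 1)"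
      using L2.pts_power_sum by blast
    have big: "p\<^sup>2 - 1 > n" using n p2 by linarith
    have "(\<Sum>h\<in>H_group p. poly (pCons 0 Q) (L1.pt h)) = 0"
    proof -
      have mem: "pCons 0 Q \<in> polys_below (p\<^sup>2)" and top: "coeff (pCons 0 Q) (p\<^sup>2 - 1) = 0"
        using Q'(1) big by (auto simp: coeff_pCons split: nat.splits)
      show ?thesis unfolding C1[OF mem] top by simp
    qed
    also have "(\<Sum>h\<in>H_group p. poly (pCons 0 Q) (L1.pt h))
        = (\<Sum>h\<in>H_group p. poly (monom (1 - v) (e + 1) + monom v (e + p)) (L2.pt h))"
    proof (intro sum.cong refl)
      fix h assume "h \<in> H_group p"
      from Q'(2)[OF this] have "poly (pCons 0 Q) (L1.pt h) = L1.pt h * L2.pt h ^ e"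
        by (simp add: poly_monom)
      also have "\<dots> = poly (monom (1 - v) (e + 1) + monom v (e + p)) (L2.pt h)"
        unfolding lattice_change[OF L2 L1, of h, folded v_def]
        by (simp add: poly_monom power_add algebra_simps)
      finally show "poly (pCons 0 Q) (L1.pt h) = \<dots>" .
    qed
    also have "\<dots> = C2 * coeff (monom (1 - v) (e + 1) + monom v (e + p)) (p\<^sup>2 - 1)"
    proof (rule C2(2))
      have "e + 1 < p\<^sup>2" "e + p < p\<^sup>2" using \<open>p\<^sup>2 \<ge> 2 * p\<close> p2 unfolding e_def by linarith+
      thus "monom (1 - v) (e + 1) + monom v (e + p) \<in> polys_below (p\<^sup>2)" by auto
    qed
    also have "\<dots> = C2 * v"
    proof -
      have "e + 1 \<noteq> p\<^sup>2 - 1" "e + p = p\<^sup>2 - 1" using \<open>p\<^sup>2 \<ge> 2 * p\<close> p2 unfolding e_def by linarith+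
      thus ?thesis by simp
    qed
    finally show False using C2(1) v by simp
  qed
qed

section \<open>Translation modules\<close>

text \<open>E is required on all polynomials, although only its values on those of degree less than n lie in the module:
  for the curve, \<open>x^(c-1) f(w) dx\<close> is a rational differential for every f, and linearity and injectivity
  of E then need no bound on degrees.\<close>

locale translation_module = translation_lattice p \<beta> for p and \<beta> :: "'k::field" +
  fixes sc :: "'k \<Rightarrow> 'w::ab_group_add \<Rightarrow> 'w" and act :: "nat \<times> nat \<Rightarrow> 'w \<Rightarrow> 'w"
    and n :: nat and V :: "'w set" and E :: "'k poly \<Rightarrow> 'w"
  assumes vs: "vector_space sc"
    and E_add: "E (f + g) = E f + E g" and E_smult: "E (smult a f) = sc a (E f)"
    and E_inj: "E f = 0 \<Longrightarrow> f = 0"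
    and V: "V = E ` polys_below n" and n: "n \<le> p\<^sup>2"
    and act: "h \<in> H_group p \<Longrightarrow> act h (E f) = E (translate (pt h) f)"
begin

sublocale vector_space sc by (rule vs)

lemma E_0 [simp]: "E 0 = 0"
  using E_smult[of 0 0] by simp

lemma E_diff: "E (f - g) = E f - E g"
  using E_add[of "f - g" g] by simp

lemma E_eq_iff: "E f = E g \<longleftrightarrow> f = g"
  using E_inj[of "f - g"] by (auto simp: E_diff)

lemma kH_module_V: "kH_module sc (H_group p) act V"
  unfolding kH_module_def subspace_def
proof (intro conjI ballI allI)
  show "0 \<in> V" unfolding V by (rule image_eqI[of _ _ 0]) simp_all
  fix u assume u: "u \<in> V"
  then obtain f where f: "f \<in> polys_below n" "u = E f" unfolding V by blast
  show sc_mem: "sc a u \<in> V" for a unfolding f(2) V E_smult[symmetric] using f(1) by (intro imageI) simp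
  show "act h u \<in> V" if "h \<in> H_group p" for h
    unfolding f(2) act[OF that] V using translate_mem[OF f(1)] by (intro imageI)
  show "act h (sc a u) = sc a (act h u)" if "h \<in> H_group p" for h a
    unfolding f(2) E_smult[symmetric] act[OF that] by (simp add: pcompose_smult)
  fix v assume "v \<in> V"
  then obtain g where g: "g \<in> polys_below n" "v = E g" unfolding V by blast
  show "u + v \<in> V" unfolding f(2) g(2) V E_add[symmetric] using f(1) g(1) by (intro imageI) simp
  show "act h (u + v) = act h u + act h v" if "h \<in> H_group p" for h
    unfolding f(2) g(2) E_add[symmetric] act[OF that] by (simp add: pcompose_add)
qed

text \<open>Take f of least degree among the nonzero polynomials in U. The differences
  \<open>f(w + a) - f(w)\<close> have smaller degree and hence vanish; so f takes the value f(0) at all \<open>p^2\<close> points of the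
  lattice, which forces it to be constant.\<close>

lemma one_mem_submodule:
  assumes U: "kH_module sc (H_group p) act U" "U \<subseteq> V" "U \<noteq> {0}"
  shows "E 1 \<in> U"
proof -
  have sub: "0 \<in> U" "\<And>u v. u \<in> U \<Longrightarrow> v \<in> U \<Longrightarrow> u + v \<in> U" "\<And>a u. u \<in> U \<Longrightarrow> sc a u \<in> U"
    and actU: "\<And>h u. h \<in> H_group p \<Longrightarrow> u \<in> U \<Longrightarrow> act h u \<in> U"
    using U(1) unfolding kH_module_def subspace_def by auto
  from U(3) sub(1) obtain u where "u \<in> U" "u \<noteq> 0" by blast
  moreover from this U(2) obtain f where "u = E f" unfolding V by blast
  ultimately have "\<exists>f. E f \<in> U \<and> f \<noteq> 0" by auto
  then obtain f where f: "E f \<in> U" "f \<noteq> 0"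
    and min: "\<And>g. E g \<in> U \<Longrightarrow> g \<noteq> 0 \<Longrightarrow> degree f \<le> degree g"
    using ex_has_least_nat[of "\<lambda>f. E f \<in> U \<and> f \<noteq> 0" _ degree] by blast
  have inv: "translate (pt h) f = f" if h: "h \<in> H_group p" for h
  proof (rule ccontr)
    assume ne: "translate (pt h) f \<noteq> f"
    have "E (translate (pt h) f - f) = act h (E f) + sc (- 1) (E f)"
      by (simp add: E_diff act[OF h])
    also have "\<dots> \<in> U" using f(1) actU[OF h] sub by blast
    finally show False using min degree_translate_diff[of f "pt h"] ne by fastforce
  qed
  have "E f \<in> V" using f(1) U(2) by (rule subsetD[rotated])
  then obtain g where "g \<in> polys_below n" "E f = E g" unfolding V by (rule imageE)
  hence fn: "f \<in> polys_below n" by (simp only: E_eq_iff)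
  have "f = [:poly f 0:]"
  proof (rule poly_eq_by_pts)
    have "p\<^sup>2 \<ge> 1" using p(2) prime_ge_1_nat by simp
    thus "[:poly f 0:] \<in> polys_below (p\<^sup>2)" by (auto simp: coeff_pCons split: nat.splits)
    show "f \<in> polys_below (p\<^sup>2)" using fn n by auto
    fix h assume "h \<in> H_group p"
    from arg_cong[OF inv[OF this], of "\<lambda>q. poly q 0"]
    show "poly f (pt h) = poly [:poly f 0:] (pt h)" by (simp add: poly_pcompose)
  qed
  moreover from this f(2) have "poly f 0 \<noteq> 0" by (metis pCons_0_0)
  ultimately have "smult (inverse (poly f 0)) f = 1"
    by (metis left_inverse mult.right_neutral one_pCons smult_0_right smult_pCons)
  hence "E 1 = sc (inverse (poly f 0)) (E f)" by (metis E_smult)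
  thus ?thesis using f(1) sub by simp
qed

lemma indecomposable: "kH_indecomposable sc (H_group p) act V"
  unfolding kH_indecomposable_def
proof (intro conjI kH_module_V notI)
  assume "\<exists>U1 U2. kH_module sc (H_group p) act U1 \<and> kH_module sc (H_group p) act U2 \<and>
    U1 \<noteq> {0} \<and> U2 \<noteq> {0} \<and> U1 \<inter> U2 = {0} \<and> V = {u1 + u2 | u1 u2. u1 \<in> U1 \<and> u2 \<in> U2}"
  then obtain U1 U2 where U: "kH_module sc (H_group p) act U1" "kH_module sc (H_group p) act U2"
    "U1 \<noteq> {0}" "U2 \<noteq> {0}" "U1 \<inter> U2 = {0}" "V = {u1 + u2 | u1 u2. u1 \<in> U1 \<and> u2 \<in> U2}" by blast
  have "0 \<in> U1" "0 \<in> U2" using U(5) by auto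
  hence "U1 \<subseteq> V" "U2 \<subseteq> V" unfolding U(6) by force+
  hence "E 1 \<in> U1 \<inter> U2" using U one_mem_submodule by blast
  hence "E 1 = 0" using U(5) by simp
  thus False using E_inj[of 1] by simp
qed

end

text \<open>The isomorphism is transported to a map G of polynomials. Evaluating G at 0 and expanding the
  translates by Taylor's formula turns polynomial functions on one lattice into polynomial functions on the other.\<close>

lemma translation_modules_iso:
  fixes \<beta>1 \<beta>2 :: "'k::field"
  assumes M1: "translation_module p \<beta>1 sc1 act1 n V1 E1"
    and M2: "translation_module p \<beta>2 sc2 act2 n V2 E2"
    and n: "2 \<le> n" "n \<le> p\<^sup>2 - 2"
    and iso: "kH_isomorphic (H_group p) sc1 act1 V1 sc2 act2 V2"
  shows "\<beta>1 = \<beta>2"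
proof -
  interpret M1: translation_module p \<beta>1 sc1 act1 n V1 E1 by (rule M1)
  interpret M2: translation_module p \<beta>2 sc2 act2 n V2 E2 by (rule M2)
  obtain F where F: "bij_betw F V1 V2" "\<And>u v. u \<in> V1 \<Longrightarrow> v \<in> V1 \<Longrightarrow> F (u + v) = F u + F v"
    "\<And>a v. v \<in> V1 \<Longrightarrow> F (sc1 a v) = sc2 a (F v)"
    "\<And>h v. h \<in> H_group p \<Longrightarrow> v \<in> V1 \<Longrightarrow> F (act1 h v) = act2 h (F v)"
    using iso unfolding kH_isomorphic_def by blast
  \<comment> \<open>F in polynomial coordinates, meaningful only on polynomials of degree less than n.\<close>
  define G where "G = (\<lambda>f. SOME f'. F (E1 f) = E2 f')"
  have G: "F (E1 f) = E2 (G f)" if "f \<in> polys_below n" for f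
  proof -
    have "E1 f \<in> V1" using that unfolding M1.V by (rule imageI)
    hence "F (E1 f) \<in> V2" using F(1) bij_betwE by blast
    then obtain f' where "F (E1 f) = E2 f'" unfolding M2.V by (rule imageE)
    thus ?thesis unfolding G_def by (rule someI)
  qed
  have mem: "E1 f \<in> V1" if "f \<in> polys_below n" for f using that unfolding M1.V by (rule imageI)
  have G_add: "G (f + g) = G f + G g" if "f \<in> polys_below n" "g \<in> polys_below n" for f g
  proof -
    have "E2 (G (f + g)) = F (E1 (f + g))" using that by (intro G[symmetric]) auto
    also have "\<dots> = E2 (G f + G g)" using that by (simp add: M1.E_add M2.E_add F(2) mem G)
    finally show ?thesis by (simp add: M2.E_eq_iff)
  qed
  have G_smult: "G (smult a f) = smult a (G f)" if "f \<in> polys_below n" for a f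
  proof -
    have "E2 (G (smult a f)) = F (E1 (smult a f))" using that by (intro G[symmetric]) auto
    also have "\<dots> = E2 (smult a (G f))" using that by (simp add: M1.E_smult M2.E_smult F(3) mem G)
    finally show ?thesis by (simp add: M2.E_eq_iff)
  qed
  have G_translate: "G (translate (M1.pt h) f) = translate (M2.pt h) (G f)"
    if f: "f \<in> polys_below n" and h: "h \<in> H_group p" for f h
  proof -
    have "E2 (G (translate (M1.pt h) f)) = F (act1 h (E1 f))"
      by (simp only: M1.act[OF h] G[OF translate_mem[OF f]])
    also have "\<dots> = E2 (translate (M2.pt h) (G f))"
      by (simp only: F(4)[OF h mem[OF f]] G[OF f] M2.act[OF h])
    finally show ?thesis by (simp only: M2.E_eq_iff)
  qed
  have G_sum: "G (\<Sum>l<k. smult (a l) (c l)) = (\<Sum>l<k. smult (a l) (G (c l)))"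
    if c: "\<And>l. c l \<in> polys_below n" for a c and k :: nat
  proof (induction k)
    case 0
    show ?case using G_smult[of 0 0] by simp
  next
    case (Suc k)
    have "smult (a l) (c l) \<in> polys_below n" "(\<Sum>l<k. smult (a l) (c l)) \<in> polys_below n" for l
      using c by (auto simp: coeff_sum)
    thus ?case using Suc c by (simp only: sum.lessThan_Suc G_add G_smult)
  qed
  show ?thesis
  proof (rule lattice_parameter_unique[OF M1.translation_lattice_axioms M2.translation_lattice_axioms n])
    fix g :: "'k poly" assume "g \<in> polys_below n"
    hence "E2 g \<in> V2" unfolding M2.V by (rule imageI)
    hence "E2 g \<in> F ` V1" using F(1) by (simp add: bij_betw_def)
    then obtain u where u: "E2 g = F u" "u \<in> V1" by (rule imageE)
    from u(2) obtain f where "u = E1 f" "f \<in> polys_below n" unfolding M1.V by (rule imageE)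
    with u have f: "f \<in> polys_below n" "E2 g = F (E1 f)" by simp_all
    hence gf: "g = G f" by (simp only: G[OF f(1)] M2.E_eq_iff)
    obtain c where c: "\<And>l. c l \<in> polys_below n" "\<And>a. translate a f = (\<Sum>l<n. smult (a ^ l) (c l))"
      using taylor_expansion[OF f(1)] by blast
    define Q where "Q = (\<Sum>l<n. monom (poly (G (c l)) 0) l)"
    show "\<exists>Q\<in>polys_below n. \<forall>h\<in>H_group p. poly g (M2.pt h) = poly Q (M1.pt h)"
    proof (intro bexI[of _ Q] ballI)
      show "Q \<in> polys_below n" by (auto simp: Q_def coeff_sum)
      fix h assume h: "h \<in> H_group p"
      have "poly g (M2.pt h) = poly (translate (M2.pt h) g) 0" by (simp add: poly_pcompose)
      also have "\<dots> = poly (G (translate (M1.pt h) f)) 0" by (simp only: gf G_translate[OF f(1) h])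
      also have "\<dots> = poly Q (M1.pt h)"
        unfolding c(2) G_sum[OF c(1)] Q_def by (simp add: poly_sum poly_monom mult.commute)
      finally show "poly g (M2.pt h) = poly Q (M1.pt h)" .
    qed
  qed
qed

section \<open>The curves\<close>

text \<open>The number d(c) counts the exponents that satisfy the degree bound at infinity.\<close>

lemma less_d_bold_iff:
  assumes "m > 0"
  shows "int i < d_bold p m c \<longleftrightarrow> m * (i + 1) + p\<^sup>2 * c < p\<^sup>2 * m"
proof -
  have "int i < d_bold p m c \<longleftrightarrow> \<lceil>(real (p\<^sup>2 * c) + 1) / real m\<rceil> \<le> int (p\<^sup>2) - int i - 1"
    unfolding d_bold_def by linarith
  also have "\<dots> \<longleftrightarrow> (real (p\<^sup>2 * c) + 1) / real m \<le> real_of_int (int (p\<^sup>2) - int i - 1)"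
    by (rule ceiling_le_iff)
  also have "\<dots> \<longleftrightarrow> real (p\<^sup>2 * c) + 1 \<le> real_of_int (int (p\<^sup>2) - int i - 1) * real m"
    using assms by (simp add: pos_divide_le_eq)
  also have "\<dots> \<longleftrightarrow> real_of_int (int (p\<^sup>2 * c) + 1) \<le> real_of_int ((int (p\<^sup>2) - int i - 1) * int m)"
    by simp
  also have "\<dots> \<longleftrightarrow> int (p\<^sup>2 * c) + 1 \<le> (int (p\<^sup>2) - int i - 1) * int m"
    by (rule of_int_le_iff)
  also have "\<dots> \<longleftrightarrow> int (m * (i + 1) + p\<^sup>2 * c) < int (p\<^sup>2 * m)"
    by (auto simp: algebra_simps)
  finally show ?thesis by (simp only: of_nat_less_iff)
qed

lemma d_bold_bounds:
  assumes "c < m" "p > 0"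
  shows "0 \<le> d_bold p m c" "d_bold p m c \<le> int (p\<^sup>2) - 1"
proof -
  have "p\<^sup>2 * c + 1 \<le> p\<^sup>2 * (c + 1)" using assms by simp
  also have "\<dots> \<le> p\<^sup>2 * m" using assms by (intro mult_left_mono) auto
  finally have "real (p\<^sup>2 * c + 1) \<le> real (p\<^sup>2 * m)" by (rule of_nat_mono)
  hence "(real (p\<^sup>2 * c) + 1) / real m \<le> real (p\<^sup>2)"
    using assms by (simp add: pos_divide_le_eq)
  hence "\<lceil>(real (p\<^sup>2 * c) + 1) / real m\<rceil> \<le> int (p\<^sup>2)"
    by (simp only: ceiling_le_iff of_int_of_nat_eq)
  thus "0 \<le> d_bold p m c" by (simp add: d_bold_def)
  have "(real (p\<^sup>2 * c) + 1) / real m > 0" using assms by (intro divide_pos_pos add_nonneg_pos) auto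
  thus "d_bold p m c \<le> int (p\<^sup>2) - 1" unfolding d_bold_def by linarith
qed

lemma (in kaehler) pullback_funpow:
  assumes "\<And>f. pullback sc d \<phi> (E f) = E (translate a f)"
  shows "(pullback sc d \<phi> ^^ i) (E f) = E (translate (of_nat i * a) f)"
proof (induction i)
  case (Suc i)
  have "translate a (translate (of_nat i * a) f) = translate (of_nat (Suc i) * a) f"
    by (simp add: pcompose_pCons algebra_simps flip: pcompose_assoc)
  thus ?case by (simp only: funpow.simps comp_apply Suc assms)
qed simp

text \<open>The passage from the two Artin--Schreier equations to the single equation \<open>x^m = A(w)\<close>, with \<open>z0 = B(w)\<close>.\<close>

locale artin_schreier_curve =
  fixes m p :: nat and \<zeta> \<alpha> :: "'k::alg_closed_field"
    and X :: "('k, 'f::field, 'w::ab_group_add) curve"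
  assumes p_char: "p = CHAR('k)" "p > 0" and m_pos: "m > 0" and p_m: "\<not> p dvd m"
    and prim: "primitive_root_of_unity m \<zeta>" and \<alpha>: "\<alpha> \<notin> range of_int" and X: "is_X m \<zeta> \<alpha> X"
begin

definition \<beta> :: 'k where "\<beta> = (SOME b. b ^ p = \<alpha>)"
definition \<gamma> :: 'k where "\<gamma> = \<beta> - \<alpha>"
definition w :: 'f where "w = cz1 X - emb X \<beta> * cz0 X"
definition B :: "'k poly" where "B = smult (inverse \<gamma>) (monom 1 p - monom 1 1)"
definition A :: "'k poly" where "A = B ^ p - B"

lemma prime_p: "prime p"
  using p_char prime_CHAR_semidom[where ?'a = 'k] by simp

lemma p_ge_2: "p \<ge> 2"
  using prime_p by (rule prime_ge_2_nat)

lemma emb: "field_hom (emb X)"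
  using X by (simp add: is_X_def)

lemma z_pow: "cz0 X ^ p - cz0 X = cx X ^ m" "cz1 X ^ p - cz1 X = emb X \<alpha> * cx X ^ m"
  using X by (simp_all add: is_X_def p_char(1))

lemma char_f: "CHAR('f) = p"
proof (rule dvd_antisym)
  have "(of_nat j :: 'f) = 0 \<longleftrightarrow> (of_nat j :: 'k) = 0" for j
    using field_hom_eq_0_iff[OF emb, of "of_nat j"] by (simp add: field_homD[OF emb])
  from this[of p] this[of "CHAR('f)"] show "CHAR('f) dvd p" "p dvd CHAR('f)"
    using p_char by (simp_all flip: of_nat_eq_0_iff_char_dvd)
qed

lemma \<beta>_pow: "\<beta> ^ p = \<alpha>"
  unfolding \<beta>_def by (rule someI_ex) (rule nth_root_exists[OF p_char(2)])

lemma \<beta>_frob: "\<beta> ^ p \<noteq> \<beta>"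
  using frob_fixed[OF p_char(1) prime_p, of \<beta>] \<alpha> \<beta>_pow by auto

sublocale translation_lattice p \<beta>
  using p_char prime_p \<beta>_frob by unfold_locales

lemma \<gamma>: "\<gamma> \<noteq> 0"
  using \<beta>_frob \<beta>_pow by (simp add: \<gamma>_def)

lemma frob_diff_f: "(a - b) ^ p = a ^ p - b ^ p" for a b :: 'f
  using frob_diff[of p a b] char_f prime_p by simp

lemma w_pow: "w ^ p - w = emb X \<gamma> * cz0 X"
proof -
  have "cz0 X ^ p = cz0 X + cx X ^ m" "cz1 X ^ p = cz1 X + emb X \<alpha> * cx X ^ m"
    using z_pow by (simp_all add: algebra_simps)
  moreover have "emb X \<beta> ^ p = emb X \<alpha>" by (simp add: \<beta>_pow flip: field_homD(7)[OF emb])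
  ultimately show ?thesis
    unfolding w_def frob_diff_f power_mult_distrib
    by (simp add: \<gamma>_def field_homD(6)[OF emb] algebra_simps)
qed

lemma evp_B: "evp (emb X) w B = cz0 X"
proof -
  have "evp (emb X) w B = emb X (inverse \<gamma>) * (w ^ p - w)"
    using emb by (simp add: B_def evp_smult evpD(6)[of "emb X"] evp_monom field_homD[OF emb])
  also have "\<dots> = cz0 X"
    unfolding w_pow using \<gamma> by (simp add: field_hom_inverse[OF emb] field_hom_eq_0_iff[OF emb])
  finally show ?thesis .
qed

lemma curve_equation: "cx X ^ m = evp (emb X) w A"
  using emb by (simp add: A_def evpD(6,7)[of "emb X"] evp_B z_pow)

lemma degree_diff_left: "degree f < degree g \<Longrightarrow> degree (g - f) = degree g" for f g :: "'k poly"
  using degree_add_eq_left[of "- f" g] by simp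

lemma degree_B: "degree B = p"
proof -
  have "degree (monom 1 p - monom 1 1 :: 'k poly) = p"
    using p_ge_2 by (subst degree_diff_left) (auto simp: degree_monom_eq)
  thus ?thesis using \<gamma> by (simp add: B_def)
qed

lemma degree_A: "degree A = p\<^sup>2"
proof -
  have "B \<noteq> 0" using degree_B p_ge_2 by auto
  hence "degree (B ^ p) = p * p" by (simp add: degree_power_eq degree_B)
  moreover have "p < p * p" using p_ge_2 by simp
  ultimately show ?thesis unfolding A_def
    by (subst degree_diff_left) (simp_all add: degree_B power2_eq_square)
qed

lemma pderiv_A: "pderiv A = [:inverse \<gamma>:]"
proof -
  have p0: "of_nat p = (0 :: 'k)" using p_char by simp
  have "pderiv B = [:- inverse \<gamma>:]"
    using p0 by (simp add: B_def pderiv_smult pderiv_diff pderiv_monom monom_0)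
  moreover have "pderiv (B ^ p) = 0"
    using p0 by (cases p) (simp_all add: pderiv_power_Suc del: power_Suc of_nat_Suc)
  ultimately show ?thesis by (simp add: A_def pderiv_diff)
qed

lemma m_nz: "of_nat m \<noteq> (0 :: 'k)"
  using p_m p_char by (simp add: of_nat_eq_0_iff_char_dvd)

text \<open>If w were a constant b, then \<open>x^m = A(b)\<close> would make x algebraic.\<close>

lemma w_transcendental: "w \<notin> range (emb X)"
proof
  assume "w \<in> range (emb X)"
  then obtain b where b: "w = emb X b" by auto
  have "evp (emb X) w P = emb X (poly P b)" for P
    using emb unfolding b by (induction P) (simp_all add: evp_pCons field_homD[OF emb])
  hence "evp (emb X) (cx X) (monom 1 m - [:poly A b:]) = 0"
    using curve_equation emb by (simp add: evpD(6)[of "emb X"] evp_monom field_homD[OF emb])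
  moreover have "coeff (monom 1 m - [:poly A b:]) m = 1"
    using m_pos by (simp add: coeff_pCons split: nat.splits)
  hence "monom 1 m - [:poly A b:] \<noteq> 0" by (metis coeff_0 zero_neq_one)
  moreover have "transcendental_over (emb X) (cx X)" using X by (simp add: is_X_def)
  ultimately show False unfolding transcendental_over_def evp_def by blast
qed

lemma generators: "is_subfield hull (range (emb X) \<union> {w, cx X}) = UNIV"
proof -
  have "S = UNIV" if S: "is_subfield S" "range (emb X) \<union> {w, cx X} \<subseteq> S" for S
  proof -
    have z0: "cz0 X = emb X (inverse \<gamma>) * (w ^ p - w)"
      unfolding w_pow using \<gamma> by (simp add: field_hom_inverse[OF emb] field_hom_eq_0_iff[OF emb])
    have "cz0 X \<in> S" unfolding z0 using S by (intro is_subfieldD[OF S(1)]) auto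
    moreover from this have "w + emb X \<beta> * cz0 X \<in> S"
      using S by (intro is_subfieldD(4,5)[OF S(1)]) auto
    hence "cz1 X \<in> S" by (simp add: w_def)
    ultimately have "range (emb X) \<union> {cx X, cz0 X, cz1 X} \<subseteq> S" using S by auto
    hence "is_subfield hull (range (emb X) \<union> {cx X, cz0 X, cz1 X}) \<subseteq> S" using S(1) by (rule hull_minimal)
    thus ?thesis using X by (auto simp: is_X_def)
  qed
  thus ?thesis unfolding hull_def by blast
qed

sublocale K: kaehler "emb X" "smul X" "dif X"
  using X by unfold_locales (auto simp: is_X_def)

lemma d_z0: "dif X (cz0 X) = smul X (- (of_nat m * cx X ^ (m - 1))) (dif X (cx X))"
  and d_z1: "dif X (cz1 X) = smul X (- (emb X \<alpha> * of_nat m * cx X ^ (m - 1))) (dif X (cx X))"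
proof -
  have p0: "of_nat p = (0 :: 'f)" using char_f by (metis of_nat_CHAR)
  have d: "dif X (z ^ p - z) = - dif X z" for z by (simp add: K.d_diff K.d_power p0)
  from z_pow[THEN arg_cong, of "dif X"]
  have "- dif X (cz0 X) = dif X (cx X ^ m)" "- dif X (cz1 X) = dif X (emb X \<alpha> * cx X ^ m)"
    by (simp_all only: d)
  hence "dif X (cz0 X) = - dif X (cx X ^ m)" "dif X (cz1 X) = - dif X (emb X \<alpha> * cx X ^ m)"
    by (metis minus_minus)+
  thus "dif X (cz0 X) = smul X (- (of_nat m * cx X ^ (m - 1))) (dif X (cx X))"
    "dif X (cz1 X) = smul X (- (emb X \<alpha> * of_nat m * cx X ^ (m - 1))) (dif X (cx X))"
    by (simp_all add: K.d_power K.d_const_mult mult.assoc)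
qed

lemma d_w: "smul X (emb X (inverse \<gamma>)) (dif X w) = smul X (of_nat m * cx X ^ (m - 1)) (dif X (cx X))"
proof -
  have "dif X w = smul X (emb X \<gamma> * (of_nat m * cx X ^ (m - 1))) (dif X (cx X))"
    unfolding w_def K.d_diff K.d_const_mult d_z0 d_z1
    by (simp add: \<gamma>_def field_homD(6)[OF emb] algebra_simps flip: K.scale_left_diff_distrib)
  moreover have "emb X (inverse \<gamma>) * emb X \<gamma> = 1"
    using \<gamma> by (simp add: field_homD(2)[OF emb] flip: field_homD(4)[OF emb])
  ultimately show ?thesis by (simp flip: mult.assoc)
qed

sublocale separable_superelliptic "emb X" w "cx X" A m \<zeta> "mu X" "smul X" "dif X" "inverse \<gamma>"
proof unfold_locales
  have mu: "k_automorphism (emb X) (mu X)" "mu X (cz0 X) = cz0 X" "mu X (cz1 X) = cz1 X"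
    "mu X (cx X) = emb X \<zeta> * cx X"
    using X by (auto simp: is_X_def)
  show h: "field_hom (mu X)" and fx: "mu X (emb X a) = emb X a" for a
    using mu by (auto simp: k_automorphism_def)
  show "mu X w = w" by (simp add: w_def field_homD[OF h] mu fx)
  show "mu X (cx X) = emb X \<zeta> * cx X" by (rule mu)
  show "A \<noteq> 0" using degree_A p_ge_2 by auto
  show "2 \<le> degree A" unfolding degree_A using p_ge_2 by (simp add: power2_eq_square mult_le_mono[of 1 _ 2, simplified])
  have "coprime p m" using prime_p p_m by (rule prime_imp_coprime)
  thus "coprime (degree A) m" unfolding degree_A by simp
  show "is_kaehler (emb X) (smul X) (dif X)" using X by (simp add: is_X_def)
  show "inverse \<gamma> \<noteq> 0" using \<gamma> by simp
qed (fact emb m_pos m_nz prim curve_equation w_transcendental generators pderiv_A d_w)+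

definition E :: "nat \<Rightarrow> 'k poly \<Rightarrow> 'w" where
  "E c f = smul X (ev f * cx X ^ (c - 1)) (dif X (cx X))"

lemma pullback_E:
  assumes "k_automorphism (emb X) \<phi>" "\<phi> w = w + emb X a" "\<phi> (cx X) = cx X"
  shows "pullback (smul X) (dif X) \<phi> (E c f) = E c (translate a f)"
proof -
  have \<phi>: "field_hom \<phi>" "\<And>a. \<phi> (emb X a) = emb X a" using assms(1) by (auto simp: k_automorphism_def)
  have "\<phi> (ev f) = evp (emb X) (\<phi> w) f" using evp_hom_comp[of \<phi> "emb X" w f] \<phi> emb by simp
  also have "\<phi> w = ev [:a, 1:]" using emb by (simp add: assms(2) evp_pCons field_homD[OF emb] add.commute)
  also have "evp (emb X) (ev [:a, 1:]) f = ev (translate a f)" using emb by (simp add: evp_pcompose)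
  finally show ?thesis
    by (simp add: E_def K.pullback_scale[OF \<phi>] field_homD[OF \<phi>(1)] assms(3))
qed

lemma H_act_E:
  "H_act X h (E c f) = E c (translate (pt h) f)"
proof -
  obtain i j where h: "h = (i, j)" by (cases h)
  have \<sigma>: "k_automorphism (emb X) (sigma X)" "sigma X (cz0 X) = cz0 X + 1" "sigma X (cz1 X) = cz1 X" "sigma X (cx X) = cx X"
    and \<tau>: "k_automorphism (emb X) (tau X)" "tau X (cz0 X) = cz0 X" "tau X (cz1 X) = cz1 X + 1" "tau X (cx X) = cx X"
    using X by (auto simp: is_X_def)
  have h\<sigma>: "field_hom (sigma X)" "\<And>a. sigma X (emb X a) = emb X a"
    and h\<tau>: "field_hom (tau X)" "\<And>a. tau X (emb X a) = emb X a"
    using \<sigma>(1) \<tau>(1) by (auto simp: k_automorphism_def)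
  have "sigma X w = w + emb X (- \<beta>)"
    by (simp add: w_def field_homD[OF h\<sigma>(1)] \<sigma> h\<sigma>(2) field_homD(5)[OF emb] algebra_simps)
  from pullback_E[OF \<sigma>(1) this \<sigma>(4)]
  have s: "pullback (smul X) (dif X) (sigma X) (E c f) = E c (translate (- \<beta>) f)" for f .
  have "tau X w = w + emb X 1"
    by (simp add: w_def field_homD[OF h\<tau>(1)] \<tau> h\<tau>(2) field_homD(2)[OF emb] algebra_simps)
  from pullback_E[OF \<tau>(1) this \<tau>(4)]
  have t: "pullback (smul X) (dif X) (tau X) (E c f) = E c (translate 1 f)" for f .
  have "H_act X h (E c f) = E c (translate (of_nat i * - \<beta>) (translate (of_nat j * 1) f))"
    unfolding H_act_def h prod.case comp_apply
      K.pullback_funpow[where \<phi> = "tau X" and E = "E c" and a = 1, OF t]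
      K.pullback_funpow[where \<phi> = "sigma X" and E = "E c" and a = "- \<beta>", OF s] ..
  also have "translate (of_nat i * - \<beta>) (translate (of_nat j * 1) f) = translate (pt h) f"
    by (simp add: h pt_def pcompose_pCons algebra_simps flip: pcompose_assoc)
  finally show ?thesis .
qed

text \<open>An eigendifferential \<open>h dx\<close> has \<open>h = r(w) x^(c-1)\<close> with r rational. Writing r with a denominator of least degree,
  a root of the denominator would be a pole, so r is a polynomial; its degree is bounded at infinity.\<close>

lemma eigenspace:
  assumes c: "1 \<le> c" "c < m"
  shows "H0_Omega_eigen X (\<zeta> ^ c) = E c ` polys_below (nat (d_bold p m c))"
proof (intro equalityI subsetI)
  have \<mu>_dx: "pullback (smul X) (dif X) (mu X) (smul X h (dif X (cx X)))
      = smul X (emb X \<zeta> * mu X h) (dif X (cx X))" for h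
    unfolding K.pullback_scale[OF \<mu>(1,2)] \<mu>(4) K.d_const_mult K.scale_scale by (simp only: mult.commute)
  have \<zeta>c: "emb X (\<zeta> ^ c) = emb X \<zeta> * emb X (\<zeta> ^ (c - 1))"
    using c by (simp flip: field_homD(4)[OF emb] power_Suc)
  have cond: "i < nat (d_bold p m c) \<longleftrightarrow> m * (i + 1) + degree A * c < degree A * m" for i
    using less_d_bold_iff[OF m_pos, of i p c] by (simp add: degree_A zless_nat_eq_int_zless)
  fix \<omega>
  {
    assume "\<omega> \<in> E c ` polys_below (nat (d_bold p m c))"
    then obtain f where f: "f \<in> polys_below (nat (d_bold p m c))" "\<omega> = E c f" by blast
    have "regular_at (smul X) (dif X) R \<omega>" if "is_place (emb X) R" for R
    proof -
      interpret curve_place "emb X" w "cx X" A m \<zeta> "mu X" "smul X" "dif X" "inverse \<gamma>" R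
        using that by unfold_locales
      show ?thesis unfolding f(2) E_def
      proof (rule regular_monomials[OF _ c])
        fix i assume "coeff f i \<noteq> 0"
        hence "\<not> nat (d_bold p m c) \<le> i" using f(1) by blast
        hence "i < nat (d_bold p m c)" by simp
        thus "m * (i + 1) + degree A * c < degree A * m" using cond by blast
      qed
    qed
    moreover have "pullback (smul X) (dif X) (mu X) \<omega> = k_scale X (\<zeta> ^ c) \<omega>"
      unfolding f(2) E_def \<mu>_dx k_scale_def K.scale_scale \<zeta>c
      by (simp add: field_homD[OF \<mu>(1)] \<mu> power_mult_distrib field_homD(7)[OF emb] mult_ac)
    ultimately show "\<omega> \<in> H0_Omega_eigen X (\<zeta> ^ c)"
      by (simp add: H0_Omega_eigen_def H0_Omega_def regular_differentials_def)
  }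
  assume "\<omega> \<in> H0_Omega_eigen X (\<zeta> ^ c)"
  hence reg: "\<And>R. is_place (emb X) R \<Longrightarrow> regular_at (smul X) (dif X) R \<omega>"
    and eig: "pullback (smul X) (dif X) (mu X) \<omega> = k_scale X (\<zeta> ^ c) \<omega>"
    by (auto simp: H0_Omega_eigen_def H0_Omega_def regular_differentials_def)
  have "is_subfield hull (range (emb X) \<union> {cx X, cz0 X, cz1 X}) = UNIV" using X by (simp add: is_X_def)
  moreover have "\<exists>f. dif X g = smul X f (dif X (cx X))" if "g \<in> {cx X, cz0 X, cz1 X}" for g
    using that d_z0 d_z1 K.scale_one[of "dif X (cx X)"] by (metis empty_iff insert_iff)
  ultimately obtain h where h: "\<omega> = smul X h (dif X (cx X))" by (rule K.rank_one)
  have "emb X \<zeta> * mu X h = emb X \<zeta> * (emb X (\<zeta> ^ (c - 1)) * h)"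
    using eig dx_nonzero unfolding h \<mu>_dx k_scale_def K.scale_scale \<zeta>c by (simp add: mult.assoc)
  moreover have "emb X \<zeta> \<noteq> 0"
    using prim m_pos by (auto simp: primitive_root_of_unity_def field_hom_eq_0_iff[OF emb] power_0_left)
  ultimately have "mu X h = emb X (\<zeta> ^ (c - 1)) * h" by simp
  moreover have "c - 1 < m" using c by simp
  ultimately obtain P0 D0 where PD0: "D0 \<noteq> 0" "h = ev P0 / ev D0 * cx X ^ (c - 1)" by (rule eigenfunction)
  have "\<exists>P. h = ev P / ev D0 * cx X ^ (c - 1)" using PD0 by blast
  with PD0(1) obtain D where D: "D \<noteq> 0" "\<exists>P. h = ev P / ev D * cx X ^ (c - 1)"
    and min: "\<And>D'. D' \<noteq> 0 \<Longrightarrow> \<exists>P. h = ev P / ev D' * cx X ^ (c - 1) \<Longrightarrow> degree D \<le> degree D'"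
    using ex_has_least_nat[of "\<lambda>D. D \<noteq> 0 \<and> (\<exists>P. h = ev P / ev D * cx X ^ (c - 1))" D0 degree] by blast
  obtain P where P: "h = ev P / ev D * cx X ^ (c - 1)" using D(2) by blast
  have "degree D = 0"
  proof (rule ccontr)
    assume "degree D \<noteq> 0"
    then obtain b where b: "poly D b = 0" using alg_closed_imp_poly_has_root[of D] by auto
    have "poly P b = 0"
      using reg D(1) b c unfolding h P by (intro regular_no_pole[of P D "c - 1"]) auto
    then obtain P1 where P1: "P = [:-b, 1:] * P1" using poly_eq_0_iff_dvd by blast
    obtain D1 where D1: "D = [:-b, 1:] * D1" using b poly_eq_0_iff_dvd by blast
    have "D1 \<noteq> 0" using D(1) D1 by auto
    have "ev [:-b, 1:] \<noteq> 0" by simp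
    hence "h = ev P1 / ev D1 * cx X ^ (c - 1)" unfolding P P1 D1 evD(4) by simp
    hence "degree D \<le> degree D1" using min \<open>D1 \<noteq> 0\<close> by blast
    moreover have "degree D = Suc (degree D1)"
      using \<open>D1 \<noteq> 0\<close> unfolding D1 by (subst degree_mult_eq) auto
    ultimately show False by simp
  qed
  then obtain a where a: "D = [:a:]" by (rule degree_eq_zeroE)
  define f where "f = smult (inverse a) P"
  have "h = ev f * cx X ^ (c - 1)"
    using emb unfolding P a f_def by (simp add: evp_smult field_hom_inverse[OF emb] divide_inverse mult_ac)
  hence \<omega>: "\<omega> = E c f" by (simp add: h E_def)
  have "f \<in> polys_below (nat (d_bold p m c))"
  proof (cases "f = 0")
    case False
    have "m * (degree f + 1) + degree A * (c - 1 + 1) < degree A * m"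
      using reg False c unfolding \<omega> E_def by (intro regular_degree_bound) auto
    hence "degree f < nat (d_bold p m c)" using cond c by simp
    thus ?thesis by (auto intro: coeff_eq_0)
  qed simp
  thus "\<omega> \<in> E c ` polys_below (nat (d_bold p m c))" unfolding \<omega> by (rule imageI)
qed

lemma translation_module:
  assumes c: "1 \<le> c" "c < m"
  shows "translation_module p \<beta> (k_scale X) (H_act X) (nat (d_bold p m c))
    (H0_Omega_eigen X (\<zeta> ^ c)) (E c)"
proof unfold_locales
  show "k_scale X a (u + v) = k_scale X a u + k_scale X a v"
    "k_scale X (a + b) u = k_scale X a u + k_scale X b u"
    "k_scale X a (k_scale X b u) = k_scale X (a * b) u"
    "k_scale X 1 u = u" for a b u v
    by (simp_all add: k_scale_def field_homD[OF emb] K.scale_right_distrib K.scale_left_distrib)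
  show "E c (f + g) = E c f + E c g" for f g
    by (simp add: E_def evD K.scale_left_distrib algebra_simps)
  show "E c (smult a f) = k_scale X a (E c f)" for a f
    using emb by (simp add: E_def k_scale_def evp_smult mult.assoc)
  show "f = 0" if "E c f = 0" for f
    using that dx_nonzero x_nz by (simp add: E_def)
  show "H0_Omega_eigen X (\<zeta> ^ c) = E c ` polys_below (nat (d_bold p m c))"
    using c by (rule eigenspace)
  show "nat (d_bold p m c) \<le> p\<^sup>2" using d_bold_bounds[of c m p] c p_char by linarith
  show "H_act X h (E c f) = E c (translate (pt h) f)" for h f by (rule H_act_E)
qed

end

theorem theorem4p1:
  fixes \<zeta> :: "'k::alg_closed_field" and m p :: nat
  assumes "p = CHAR('k)" and "p > 0"
    and "m > 0" and "\<not> p dvd m"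
    and "primitive_root_of_unity m \<zeta>"
  shows "(\<forall>\<alpha> c (X :: ('k, 'f::field, 'w::ab_group_add) curve).
            \<alpha> \<notin> range of_int \<and> 1 \<le> c \<and> c \<le> m - 1 \<and> is_X m \<zeta> \<alpha> X \<longrightarrow>
            kH_indecomposable (k_scale X) (H_group p) (H_act X) (H0_Omega_eigen X (\<zeta> ^ c)))
       \<and> (\<forall>\<alpha>1 \<alpha>2 c (X1 :: ('k, 'f, 'w) curve) (X2 :: ('k, 'g::field, 'v::ab_group_add) curve).
            \<alpha>1 \<notin> range of_int \<and> \<alpha>2 \<notin> range of_int \<and> 1 \<le> c \<and> c \<le> m - 1 \<and>
            is_X m \<zeta> \<alpha>1 X1 \<and> is_X m \<zeta> \<alpha>2 X2 \<and>
            d_bold p m c \<notin> {0, 1, int (p ^ 2) - 1} \<and>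
            kH_isomorphic (H_group p)
              (k_scale X1) (H_act X1) (H0_Omega_eigen X1 (\<zeta> ^ c))
              (k_scale X2) (H_act X2) (H0_Omega_eigen X2 (\<zeta> ^ c)) \<longrightarrow>
            \<alpha>1 = \<alpha>2)"
proof (intro conjI allI impI; elim conjE)
  fix \<alpha> c and X :: "('k, 'f, 'w) curve"
  assume \<alpha>: "\<alpha> \<notin> range of_int" and c: "1 \<le> c" "c \<le> m - 1" and X: "is_X m \<zeta> \<alpha> X"
  interpret artin_schreier_curve m p \<zeta> \<alpha> X
    using assms \<alpha> X by unfold_locales
  interpret translation_module p \<beta> "k_scale X" "H_act X" "nat (d_bold p m c)"
    "H0_Omega_eigen X (\<zeta> ^ c)" "E c"
    using c m_pos by (intro translation_module) auto
  show "kH_indecomposable (k_scale X) (H_group p) (H_act X) (H0_Omega_eigen X (\<zeta> ^ c))"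
    by (rule indecomposable)
next
  fix \<alpha>1 \<alpha>2 c and X1 :: "('k, 'f, 'w) curve" and X2 :: "('k, 'g, 'v) curve"
  assume \<alpha>: "\<alpha>1 \<notin> range of_int" "\<alpha>2 \<notin> range of_int" and c: "1 \<le> c" "c \<le> m - 1"
    and X: "is_X m \<zeta> \<alpha>1 X1" "is_X m \<zeta> \<alpha>2 X2" and d: "d_bold p m c \<notin> {0, 1, int (p ^ 2) - 1}"
    and iso: "kH_isomorphic (H_group p)
              (k_scale X1) (H_act X1) (H0_Omega_eigen X1 (\<zeta> ^ c))
              (k_scale X2) (H_act X2) (H0_Omega_eigen X2 (\<zeta> ^ c))"
  interpret X1: artin_schreier_curve m p \<zeta> \<alpha>1 X1
    using assms \<alpha> X by unfold_locales
  interpret X2: artin_schreier_curve m p \<zeta> \<alpha>2 X2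
    using assms \<alpha> X by unfold_locales
  have c': "c < m" using c assms(3) by simp
  have "2 \<le> nat (d_bold p m c)" "nat (d_bold p m c) \<le> p\<^sup>2 - 2"
    using d d_bold_bounds[OF c' assms(2)] by (simp_all del: of_nat_power) linarith+
  from translation_modules_iso[OF X1.translation_module[OF c(1) c'] X2.translation_module[OF c(1) c'] this iso]
  have "X1.\<beta> = X2.\<beta>" .
  thus "\<alpha>1 = \<alpha>2" using X1.\<beta>_pow X2.\<beta>_pow by argo
qed

end
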